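(* Let $c>2$ be an integer. (1) If $n\ge c$ is an integer with $n\equiv c \pmod 2$ and $(c,n)$ is not firm, then $(c,n+1)$ is not firm. (2) Let $N_c := \min\{n : (c,n) \text{ is firm}\}$ (with $N_c=\infty$ if no such $n$ exists). If $N_c$ is finite, then $N_c\equiv c \pmod 2$.
   Context: Fix an algebraically closed ground field $k$ of characteristic zero. For positive integers $a_1,\ldots,a_c$ and $n\ge c$, a complete intersection $X=X(a_1,\ldots,a_c)\subset\mathbb{P}^n_k$ of codimension $c$ is a closed subscheme of codimension $c$ whose defining ideal is generated by $c$ homogeneous polynomials $f_1,\ldots,f_c$ (a regular sequence) with $\deg f_i=a_i$; $(a_1,\ldots,a_c)$ is its degree sequence, considered up to permutation. $P_X(t)$ denotes the Hilbert polynomial of $X\subset \mathbb{P}^n$. For integers $n\ge c\ge 1$, the pair $(c,n)$ is called firm if the degree sequence of any codimension $c$ complete intersection in $\mathbb{P}^n$ is determined by its Hilbert polynomial; that is, whenever $X(a_1,\ldots,a_c)$ and $X(b_1,\ldots,b_c)$ in $\mathbb{P}^n$ have the same Hilbert polynomial, $(b_1,\ldots,b_c)$ is a permutation of $(a_1,\ldots,a_c)$. *)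

theory Defs
  imports
    "HOL-Library.Poly_Mapping"
    "HOL-Library.Extended_Nat"
    "HOL-Library.Multiset"
    "HOL-Computational_Algebra.Polynomial"
    "HOL-Number_Theory.Cong"
    "HOL-Algebra.Ideal"
begin

section \<open>The homogeneous coordinate ring of projective space\<close>

text \<open>Monomials are finitely supported exponent vectors. The type \<open>'k mpoly\<close> has the
  countably many variables \<open>x\<^sub>0, x\<^sub>1, \<dots>\<close>; \<open>coord_ring n\<close> is its subring \<open>k[x\<^sub>0, \<dots>, x\<^sub>n]\<close>.\<close>

type_synonym 'k mpoly = "(nat \<Rightarrow>\<^sub>0 nat) \<Rightarrow>\<^sub>0 'k"

definition coord_ring :: "nat \<Rightarrow> 'k::field mpoly ring" where
  "coord_ring n =
    \<lparr>carrier = {p. \<forall>m\<in>Poly_Mapping.keys p. Poly_Mapping.keys m \<subseteq> {..n}},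
     mult = (*), one = 1, zero = 0, add = (+)\<rparr>"

definition variable :: "nat \<Rightarrow> 'k::field mpoly" where
  "variable i = Poly_Mapping.single (Poly_Mapping.single i 1) 1"

definition scale :: "'k::field \<Rightarrow> 'k mpoly \<Rightarrow> 'k mpoly" where
  "scale a p = Poly_Mapping.single 0 a * p"

definition monom_degree :: "(nat \<Rightarrow>\<^sub>0 nat) \<Rightarrow> nat" where
  "monom_degree m = (\<Sum>i\<in>Poly_Mapping.keys m. Poly_Mapping.lookup m i)"

text \<open>The zero polynomial is homogeneous of every degree.\<close>

definition homogeneous :: "nat \<Rightarrow> 'k::field mpoly \<Rightarrow> bool" where
  "homogeneous d p \<longleftrightarrow> (\<forall>m\<in>Poly_Mapping.keys p. monom_degree m = d)"

definition homogeneous_ideal :: "nat \<Rightarrow> 'k::field mpoly set \<Rightarrow> bool" where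
  "homogeneous_ideal n I \<longleftrightarrow>
    ideal I (coord_ring n) \<and> I = genideal (coord_ring n) {p \<in> I. \<exists>d. homogeneous d p}"

section \<open>Closed subschemes of projective space and their codimension\<close>

text \<open>A closed subscheme of \<open>\<P>\<^sup>n\<close> is represented by its defining ideal. The defining ideals
  are exactly the homogeneous ideals that are saturated with respect to \<open>(x\<^sub>0, \<dots>, x\<^sub>n)\<close>;
  the unit ideal corresponds to the empty subscheme.\<close>

definition defining_ideal :: "nat \<Rightarrow> 'k::field mpoly set \<Rightarrow> bool" where
  "defining_ideal n I \<longleftrightarrow> homogeneous_ideal n I \<and>
    (\<forall>p\<in>carrier (coord_ring n). (\<forall>i\<le>n. \<exists>e. variable i ^ e * p \<in> I) \<longrightarrow> p \<in> I)"

text \<open>The points of \<open>Proj k[x\<^sub>0, \<dots>, x\<^sub>n]\<close>. They correspond, reversing inclusions, to the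
  irreducible closed subsets of \<open>\<P>\<^sup>n\<close>.\<close>

definition proj_points :: "nat \<Rightarrow> 'k::field mpoly set set" where
  "proj_points n = {P. homogeneous_ideal n P \<and> primeideal P (coord_ring n) \<and>
    \<not> variable ` {..n} \<subseteq> P}"

text \<open>Codimension of an irreducible closed subset: the supremum of the lengths of chains of
  irreducible closed subsets starting with it, written here with the opposite chains of primes.\<close>

definition point_codim :: "nat \<Rightarrow> 'k::field mpoly set \<Rightarrow> enat" where
  "point_codim n P =
    Sup {enat r | r. \<exists>C. (\<forall>i\<le>r. C i \<in> proj_points n) \<and> (\<forall>i<r. C i \<subset> C (Suc i)) \<and> C r = P}"

text \<open>Codimension of an arbitrary closed subset: the infimum of the codimensions of its
  irreducible closed subsets (\<open>\<infinity>\<close> for the empty set).\<close>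

definition codim :: "nat \<Rightarrow> 'k::field mpoly set \<Rightarrow> enat" where
  "codim n I = (INF P\<in>{P \<in> proj_points n. I \<subseteq> P}. point_codim n P)"

section \<open>Complete intersections\<close>

definition regular_sequence :: "nat \<Rightarrow> 'k::field mpoly list \<Rightarrow> bool" where
  "regular_sequence n fs \<longleftrightarrow>
    set fs \<subseteq> carrier (coord_ring n) \<and>
    (\<forall>i<length fs. \<forall>g\<in>carrier (coord_ring n).
       fs ! i * g \<in> genideal (coord_ring n) (set (take i fs)) \<longrightarrow>
       g \<in> genideal (coord_ring n) (set (take i fs))) \<and>
    genideal (coord_ring n) (set fs) \<noteq> carrier (coord_ring n)"

text \<open>\<open>complete_intersection n as I\<close>: the closed subscheme of \<open>\<P>\<^sup>n\<close> with defining ideal \<open>I\<close> is a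
  complete intersection \<open>X(as)\<close> of codimension \<open>length as\<close>.\<close>

definition complete_intersection :: "nat \<Rightarrow> nat list \<Rightarrow> 'k::field mpoly set \<Rightarrow> bool" where
  "complete_intersection n as I \<longleftrightarrow>
    (\<forall>a\<in>set as. 0 < a) \<and> defining_ideal n I \<and> codim n I = enat (length as) \<and>
    (\<exists>fs. list_all2 homogeneous as fs \<and> regular_sequence n fs \<and>
          I = genideal (coord_ring n) (set fs))"

section \<open>Hilbert polynomials\<close>

text \<open>The dimension of the degree \<open>d\<close> part of \<open>k[x\<^sub>0, \<dots>, x\<^sub>n] / I\<close>.\<close>

definition hilbert_function :: "nat \<Rightarrow> 'k::field mpoly set \<Rightarrow> nat \<Rightarrow> nat" where
  "hilbert_function n I d =
    vector_space.dim scale {p :: 'k mpoly. p \<in> carrier (coord_ring n) \<and> homogeneous d p} -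
    vector_space.dim scale {p \<in> I. homogeneous d p}"

definition hilbert_polynomial :: "nat \<Rightarrow> 'k::field mpoly set \<Rightarrow> rat poly" where
  "hilbert_polynomial n I =
    (THE P. eventually (\<lambda>d. poly P (of_nat d) = of_nat (hilbert_function n I d)) sequentially)"

section \<open>Firm pairs\<close>

text \<open>The ground field enters through a type argument. Degree sequences are compared up to
  permutation, that is, as multisets.\<close>

definition firm :: "'k::{alg_closed_field, field_char_0} itself \<Rightarrow> nat \<Rightarrow> nat \<Rightarrow> bool" where
  "firm _ c n \<longleftrightarrow> 1 \<le> c \<and> c \<le> n \<and>
    (\<forall>as bs. \<forall>(I :: 'k mpoly set) (J :: 'k mpoly set).
       length as = c \<and> length bs = c \<and>
       complete_intersection n as I \<and> complete_intersection n bs J \<and>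
       hilbert_polynomial n I = hilbert_polynomial n J \<longrightarrow> mset bs = mset as)"

text \<open>The infimum of the empty set is \<open>\<infinity>\<close>.\<close>

definition firm_threshold :: "'k::{alg_closed_field, field_char_0} itself \<Rightarrow> nat \<Rightarrow> enat" where
  "firm_threshold k c = (INF n\<in>{n. firm k c n}. enat n)"

section \<open>Well-formedness of the encoding\<close>

lemma vector_space_scale: "vector_space (scale :: 'k::field \<Rightarrow> _)"
  by unfold_locales
    (simp_all add: scale_def algebra_simps Poly_Mapping.single_add mult_single
      flip: mult.assoc)

lemma cring_coord_ring: "cring (coord_ring n :: 'k::field mpoly ring)"
proof -
  define S where "S = {p :: 'k mpoly. \<forall>m\<in>Poly_Mapping.keys p. Poly_Mapping.keys m \<subseteq> {..n}}"
  have R: "coord_ring n = \<lparr>carrier = S, mult = (*), one = 1, zero = 0, add = (+)\<rparr>"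
    by (simp add: coord_ring_def S_def)
  have zero: "0 \<in> S" and one: "1 \<in> S"
    by (simp_all add: S_def flip: single_one)
  have add: "p + q \<in> S" if "p \<in> S" "q \<in> S" for p q
    using that Poly_Mapping.keys_add[of p q] unfolding S_def by blast
  have mult: "p * q \<in> S" if "p \<in> S" "q \<in> S" for p q
  proof -
    have "Poly_Mapping.keys m \<subseteq> {..n}" if m: "m \<in> Poly_Mapping.keys (p * q)" for m
    proof -
      obtain a b where ab: "m = a + b" "a \<in> Poly_Mapping.keys p" "b \<in> Poly_Mapping.keys q"
        using m keys_mult[of p q] by blast
      then show ?thesis
        using \<open>p \<in> S\<close> \<open>q \<in> S\<close> Poly_Mapping.keys_add[of a b] unfolding S_def by blast
    qed
    then show ?thesis by (simp add: S_def)
  qed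
  have neg: "\<exists>q\<in>S. p + q = 0" if "p \<in> S" for p
    using that by (intro bexI[of _ "- p"]) (simp_all add: S_def)
  have "comm_monoid (coord_ring n :: 'k mpoly ring)"
    unfolding R by (rule comm_monoidI) (simp_all add: mult one ac_simps)
  moreover have "abelian_group (coord_ring n :: 'k mpoly ring)"
    unfolding R by (rule abelian_groupI) (simp_all add: add zero add.commute add.left_commute neg)
  ultimately show ?thesis
    unfolding R by (intro cringI) (simp_all add: distrib_right)
qed

end

theory Submission
  imports Defs "HOL-Computational_Algebra.Polynomial_FPS"
begin

text \<open>Let \<open>A(t) = (1 - t^a\<^sub>1) \<dots> (1 - t^a\<^sub>c)\<close> and let \<open>B(t)\<close> be the same product for \<open>b\<^sub>1, \<dots>, b\<^sub>c\<close>.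
  The coordinate ring of \<open>X(a\<^sub>1, \<dots>, a\<^sub>c)\<close> in \<open>\<P>\<^sup>n\<close> has Hilbert series \<open>A(t) / (1 - t)^(n+1)\<close>
  (\<open>hilbert_series_complete_intersection\<close>). Two rational functions of this kind have coefficients that
  eventually agree exactly when their difference is a polynomial, so \<open>X(a)\<close> and \<open>X(b)\<close> have the same
  Hilbert polynomial if and only if \<open>(1 - t)^(n+1)\<close> divides \<open>A - B\<close>
  (\<open>hilbert_polynomial_eq_iff_dvd\<close>). Since every sequence of \<open>c \<le> n\<close> positive integers is the
  degree sequence of a complete intersection in \<open>\<P>\<^sup>n\<close>, namely the one cut out by
  \<open>x\<^sub>0^a\<^sub>1, \<dots>, x\<^sub>c\<^sub>-\<^sub>1^a\<^sub>c\<close>, firmness becomes a question about the polynomials \<open>A\<close> and \<open>B\<close> alone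
  (\<open>not_firm_iff\<close>).

  The substitution \<open>t \<mapsto> 1/t\<close> multiplies \<open>A\<close> by \<open>(-1)^c t^-(a\<^sub>1 + \<dots> + a\<^sub>c)\<close>. If \<open>a\<close> and \<open>b\<close> have equal
  sums, then \<open>A - B\<close> has the same symmetry, and unless it is zero its order of vanishing at \<open>t = 1\<close> is
  congruent to \<open>c\<close> modulo 2 (\<open>dvd_numerator_diff_Suc\<close>). Divisibility of \<open>A - B\<close> by
  \<open>(1 - t)^(c+2)\<close> says precisely that \<open>a\<close> and \<open>b\<close> have equal products and equal sums
  (\<open>dvd_numerator_diff_iff\<close>). Hence, for \<open>n \<equiv> c\<close> modulo 2 and \<open>n \<ge> c + 2\<close>, a pair of sequences that
  contradicts firmness in \<open>\<P>\<^sup>n\<close> contradicts it in \<open>\<P>\<^sup>n\<^sup>+\<^sup>1\<close> as well. For \<open>n = c\<close> the equality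
  of sums is a new condition, but \<open>(1, 6, 6)\<close> and \<open>(2, 2, 9)\<close>, padded with ones, have equal products and
  equal sums, so \<open>(c, c + 1)\<close> is not firm; this is where \<open>c > 2\<close> enters. The statement on \<open>N\<^sub>c\<close>
  follows: if the least firm \<open>n\<close> had the wrong parity, its predecessor would have the right parity and
  would not be firm.

  The geometric input is elementary. The Hilbert series comes from the exact sequence of
  multiplication by a nonzerodivisor, applied to the given regular sequence and to \<open>x\<^sub>0, \<dots>, x\<^sub>n\<close>. The
  codimension of the monomial complete intersections needs an upper bound on the length of chains of
  homogeneous primes below \<open>(x\<^sub>0, \<dots>, x\<^sub>c\<^sub>-\<^sub>1)\<close>. It is obtained from the growth of Hilbert
  functions: each strict inclusion of primes raises the order of growth by at least one, and no
  Hilbert function grows faster than \<open>d^n\<close> (\<open>point_codim_variable_ideal_le\<close>).\<close>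

section \<open>Monomials and graded pieces\<close>

lemma monom_degree_eq_sum:
  assumes "finite A" "Poly_Mapping.keys m \<subseteq> A"
  shows "monom_degree m = (\<Sum>i\<in>A. Poly_Mapping.lookup m i)"
  unfolding monom_degree_def
  by (rule sum.mono_neutral_left) (use assms in \<open>auto simp: in_keys_iff\<close>)

lemma monom_degree_add: "monom_degree (m + m') = monom_degree m + monom_degree m'"
proof -
  let ?A = "Poly_Mapping.keys m \<union> Poly_Mapping.keys m'"
  have "monom_degree (m + m') = (\<Sum>i\<in>?A. Poly_Mapping.lookup (m + m') i)"
    using Poly_Mapping.keys_add[of m m'] by (intro monom_degree_eq_sum) auto
  also have "\<dots> = (\<Sum>i\<in>?A. Poly_Mapping.lookup m i) + (\<Sum>i\<in>?A. Poly_Mapping.lookup m' i)"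
    by (simp add: lookup_add sum.distrib)
  also have "\<dots> = monom_degree m + monom_degree m'"
    by (simp flip: monom_degree_eq_sum)
  finally show ?thesis .
qed

lemma monom_degree_single [simp]: "monom_degree (Poly_Mapping.single i e) = e"
  by (simp add: monom_degree_def)

lemma monom_degree_eq_0_iff: "monom_degree m = 0 \<longleftrightarrow> m = 0"
proof
  assume "monom_degree m = 0"
  then have "Poly_Mapping.lookup m i = 0" for i
    by (cases "i \<in> Poly_Mapping.keys m") (auto simp: monom_degree_def in_keys_iff)
  then show "m = 0" by (intro poly_mapping_eqI) simp
qed (simp add: monom_degree_def)

lemma finite_monomials:
  "finite {m. Poly_Mapping.keys m \<subseteq> {..n} \<and> monom_degree m = d}" (is "finite ?M")
proof -
  have "Poly_Mapping.lookup ` ?M \<subseteq> {f. (\<forall>i. (i \<in> {..n} \<longrightarrow> f i \<in> {..d}) \<and> (i \<notin> {..n} \<longrightarrow> f i = 0))}"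
  proof (clarsimp, safe)
    fix m :: "nat \<Rightarrow>\<^sub>0 nat" and i assume m: "Poly_Mapping.keys m \<subseteq> {..n}"
    { assume "i \<le> n"
      have "monom_degree m = (\<Sum>i\<in>{..n}. Poly_Mapping.lookup m i)"
        by (rule monom_degree_eq_sum) (use m in auto)
      then show "Poly_Mapping.lookup m i \<le> monom_degree m"
        using \<open>i \<le> n\<close> member_le_sum[of i "{..n}" "Poly_Mapping.lookup m"] by simp }
    { assume "\<not> i \<le> n"
      then show "Poly_Mapping.lookup m i = 0" using m by (meson atMost_iff in_keys_iff subsetD) }
  qed
  then have "finite (Poly_Mapping.lookup ` ?M)"
    by (rule finite_subset) (rule finite_set_of_finite_funs, simp_all)
  then show ?thesis
    by (rule finite_imageD) (auto intro!: inj_onI poly_mapping_eqI dest: fun_cong)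
qed

lemma sum_single_keys:
  fixes p :: "'k::field mpoly"
  shows "(\<Sum>m\<in>Poly_Mapping.keys p. Poly_Mapping.single m (Poly_Mapping.lookup p m)) = p"
proof (rule poly_mapping_eqI)
  fix k
  have "(\<Sum>m\<in>Poly_Mapping.keys p. Poly_Mapping.lookup p m when m = k)
      = (\<Sum>m\<in>Poly_Mapping.keys p. if m = k then Poly_Mapping.lookup p m else 0)"
    by (intro sum.cong) auto
  then show "Poly_Mapping.lookup (\<Sum>m\<in>Poly_Mapping.keys p.
          Poly_Mapping.single m (Poly_Mapping.lookup p m)) k = Poly_Mapping.lookup p k"
    by (simp add: lookup_sum lookup_single in_keys_iff)
qed

lemma lookup_single_times:
  fixes p :: "'k::field mpoly"
  shows "Poly_Mapping.lookup (Poly_Mapping.single s a * p) (s + m) = a * Poly_Mapping.lookup p m"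
proof -
  have "Poly_Mapping.single s a * p
      = (\<Sum>u\<in>Poly_Mapping.keys p. Poly_Mapping.single (s + u) (a * Poly_Mapping.lookup p u))"
    by (subst sum_single_keys[of p, symmetric]) (simp add: sum_distrib_left mult_single)
  then have "Poly_Mapping.lookup (Poly_Mapping.single s a * p) (s + m)
      = (\<Sum>u\<in>Poly_Mapping.keys p. if u = m then a * Poly_Mapping.lookup p u else 0)"
    by (auto simp add: lookup_sum lookup_single when_def intro!: sum.cong)
  then show ?thesis
    by (simp add: in_keys_iff)
qed

lemma keys_single_times:
  fixes p :: "'k::field mpoly"
  assumes "a \<noteq> 0"
  shows "Poly_Mapping.keys (Poly_Mapping.single s a * p) = (+) s ` Poly_Mapping.keys p"
proof
  show "Poly_Mapping.keys (Poly_Mapping.single s a * p) \<subseteq> (+) s ` Poly_Mapping.keys p"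
    using keys_mult[of "Poly_Mapping.single s a" p] assms by (force split: if_splits)
  show "(+) s ` Poly_Mapping.keys p \<subseteq> Poly_Mapping.keys (Poly_Mapping.single s a * p)"
    using assms by (auto simp: in_keys_iff lookup_single_times)
qed

lemma lookup_scale: "Poly_Mapping.lookup (scale a p) m = a * Poly_Mapping.lookup p m"
  using lookup_single_times[of 0 a p m] by (simp add: scale_def)

lemma variable_power: "variable i ^ e = Poly_Mapping.single (Poly_Mapping.single i e) 1"
  by (induction e)
    (simp_all add: variable_def mult_single flip: Poly_Mapping.single_add)

lemma keys_variable_power_times:
  "Poly_Mapping.keys (variable i ^ e * p) = (+) (Poly_Mapping.single i e) ` Poly_Mapping.keys p"
  by (simp add: variable_power keys_single_times)

text \<open>Selecting monomials by a predicate serves two purposes: homogeneous components, and normal forms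
  modulo an ideal generated by variables.\<close>

definition restrict_monomials :: "((nat \<Rightarrow>\<^sub>0 nat) \<Rightarrow> bool) \<Rightarrow> 'k::field mpoly \<Rightarrow> 'k mpoly" where
  "restrict_monomials P p =
    (\<Sum>m\<in>Poly_Mapping.keys p. Poly_Mapping.single m (if P m then Poly_Mapping.lookup p m else 0))"

lemma lookup_restrict_monomials:
  "Poly_Mapping.lookup (restrict_monomials P p) m = (if P m then Poly_Mapping.lookup p m else 0)"
proof -
  have "Poly_Mapping.lookup (restrict_monomials P p) m
     = (\<Sum>u\<in>Poly_Mapping.keys p. if u = m then (if P u then Poly_Mapping.lookup p u else 0) else 0)"
    unfolding restrict_monomials_def lookup_sum lookup_single when_def
    by (intro sum.cong) auto
  then show ?thesis by (simp add: in_keys_iff)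
qed

lemma keys_restrict_monomials:
  "Poly_Mapping.keys (restrict_monomials P p) = {m \<in> Poly_Mapping.keys p. P m}"
  by (auto simp: in_keys_iff lookup_restrict_monomials split: if_splits)

definition component :: "nat \<Rightarrow> 'k::field mpoly \<Rightarrow> 'k mpoly" where
  "component d = restrict_monomials (\<lambda>m. monom_degree m = d)"

lemma lookup_component:
  "Poly_Mapping.lookup (component d p) m = (if monom_degree m = d then Poly_Mapping.lookup p m else 0)"
  by (simp add: component_def lookup_restrict_monomials)

lemma keys_component: "Poly_Mapping.keys (component d p) \<subseteq> Poly_Mapping.keys p"
  by (auto simp: component_def keys_restrict_monomials)

lemma homogeneous_component [simp]: "homogeneous d (component d p)"
  by (auto simp: component_def keys_restrict_monomials homogeneous_def)

lemma component_add: "component d (p + q) = component d p + component d q"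
  by (rule poly_mapping_eqI) (simp add: lookup_component lookup_add)

lemma component_0 [simp]: "component d 0 = 0"
  by (rule poly_mapping_eqI) (simp add: lookup_component)

lemma component_sum: "component d (sum f A) = (\<Sum>x\<in>A. component d (f x))"
  by (induction A rule: infinite_finite_induct) (simp_all add: component_add)

lemma component_homogeneous:
  "homogeneous e p \<Longrightarrow> component d p = (if d = e then p else 0)"
  by (rule poly_mapping_eqI) (auto simp: lookup_component homogeneous_def in_keys_iff)

lemma sum_components:
  obtains N where "p = (\<Sum>d\<le>N. component d p)"
proof -
  obtain N where N: "\<forall>m\<in>Poly_Mapping.keys p. monom_degree m \<le> N"
    by (meson Max_ge finite_imageI finite_keys imageI)
  have "p = (\<Sum>d\<le>N. component d p)"
  proof (rule poly_mapping_eqI)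
    fix m
    show "Poly_Mapping.lookup p m = Poly_Mapping.lookup (\<Sum>d\<le>N. component d p) m"
      using N by (cases "m \<in> Poly_Mapping.keys p")
        (auto simp: lookup_sum lookup_component in_keys_iff)
  qed
  then show ?thesis ..
qed

lemma homogeneous_0 [simp]: "homogeneous d 0"
  by (simp add: homogeneous_def)

lemma homogeneous_mult: "homogeneous d p \<Longrightarrow> homogeneous e q \<Longrightarrow> homogeneous (d + e) (p * q)"
  using keys_mult[of p q] by (fastforce simp: homogeneous_def monom_degree_add)

lemma homogeneous_add: "homogeneous d p \<Longrightarrow> homogeneous d q \<Longrightarrow> homogeneous d (p + q)"
  using Poly_Mapping.keys_add[of p q] by (auto simp: homogeneous_def)

lemma homogeneous_scale: "homogeneous d p \<Longrightarrow> homogeneous d (scale a p)"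
  by (auto simp: homogeneous_def in_keys_iff lookup_scale)

lemma homogeneous_variable_power: "homogeneous e (variable i ^ e)"
  by (simp add: homogeneous_def variable_power)

lemma component_mult_homogeneous:
  assumes "homogeneous a f"
  shows "component d (f * g) = (if a \<le> d then f * component (d - a) g else 0)"
proof -
  obtain N where N: "g = (\<Sum>e\<le>N. component e g)" by (rule sum_components)
  have *: "component d (f * component e g) = (if a + e = d then f * component e g else 0)" for e
    by (auto simp: component_homogeneous[OF homogeneous_mult[OF assms homogeneous_component]])
  have "f * g = (\<Sum>e\<le>N. f * component e g)"
    by (subst N) (simp add: sum_distrib_left)
  then have "component d (f * g) = (\<Sum>e\<le>N. if a + e = d then f * component e g else 0)"
    by (simp add: component_sum *)
  also have "\<dots> = (if a \<le> d then f * (\<Sum>e\<le>N. if d - a = e then component e g else 0) else 0)"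
    unfolding sum_distrib_left by (auto intro!: sum.cong sum.neutral)
  also have "(\<Sum>e\<le>N. if d - a = e then component e g else 0) = (\<Sum>e\<le>N. component (d - a) (component e g))"
    by (auto intro!: sum.cong simp: component_homogeneous[OF homogeneous_component])
  also have "\<dots> = component (d - a) g"
    by (subst (2) N) (simp add: component_sum)
  finally show ?thesis .
qed

section \<open>Ideals of the coordinate ring\<close>

lemma coord_ring_simps [simp]:
  "monoid.mult (coord_ring n) = (*)" "one (coord_ring n) = 1"
  "zero (coord_ring n) = 0" "add (coord_ring n) = (+)"
  by (simp_all add: coord_ring_def)

lemma in_coord_ring_iff:
  "p \<in> carrier (coord_ring n) \<longleftrightarrow> (\<forall>m\<in>Poly_Mapping.keys p. Poly_Mapping.keys m \<subseteq> {..n})"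
  by (simp add: coord_ring_def)

interpretation coord: cring "coord_ring n :: 'k::field mpoly ring" for n
  by (rule cring_coord_ring)

lemma coord_ring_0 [simp]: "0 \<in> carrier (coord_ring n)"
  and coord_ring_1 [simp]: "1 \<in> carrier (coord_ring n)"
  and coord_ring_add: "p \<in> carrier (coord_ring n) \<Longrightarrow> q \<in> carrier (coord_ring n) \<Longrightarrow> p + q \<in> carrier (coord_ring n)"
  and coord_ring_mult: "p \<in> carrier (coord_ring n) \<Longrightarrow> q \<in> carrier (coord_ring n) \<Longrightarrow> p * q \<in> carrier (coord_ring n)"
  using coord.zero_closed[of n] coord.one_closed[of n] coord.a_closed[of p n q]
    coord.m_closed[of p n q] by simp_all

lemma coord_ring_single: "Poly_Mapping.keys m \<subseteq> {..n} \<Longrightarrow> Poly_Mapping.single m a \<in> carrier (coord_ring n)"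
  by (simp add: in_coord_ring_iff)

lemma coord_ring_variable_power: "i \<le> n \<Longrightarrow> variable i ^ e \<in> carrier (coord_ring n)"
  by (simp add: variable_power coord_ring_single)

lemma coord_ring_component: "p \<in> carrier (coord_ring n) \<Longrightarrow> component d p \<in> carrier (coord_ring n)"
  using keys_component by (fastforce simp: in_coord_ring_iff)

lemma coord_ring_uminus: "p \<in> carrier (coord_ring n) \<Longrightarrow> - p \<in> carrier (coord_ring n)"
  by (simp add: in_coord_ring_iff)

lemma ideal_coord_ring_iff:
  "ideal I (coord_ring n) \<longleftrightarrow> I \<subseteq> carrier (coord_ring n) \<and> 0 \<in> I \<and> (\<forall>p\<in>I. \<forall>q\<in>I. p + q \<in> I) \<and>
    (\<forall>p\<in>I. \<forall>r\<in>carrier (coord_ring n). r * p \<in> I)" (is "_ \<longleftrightarrow> ?R")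
proof
  assume "ideal I (coord_ring n)"
  then interpret ideal I "coord_ring n" .
  show ?R
    using a_subset zero_closed a_closed I_l_closed by simp
next
  assume R: ?R
  have neg: "- p \<in> I" if "p \<in> I" for p
  proof -
    have "- 1 * p \<in> I" using R that coord_ring_uminus[OF coord_ring_1] by blast
    then show ?thesis by simp
  qed
  have "subgroup I (add_monoid (coord_ring n))"
  proof (rule group.subgroupI)
    show "group (add_monoid (coord_ring n))" by (rule coord.a_group)
    show "inv\<^bsub>add_monoid (coord_ring n)\<^esub> a \<in> I" if "a \<in> I" for a
    proof -
      have "\<ominus>\<^bsub>coord_ring n\<^esub> a = - a"
        by (rule coord.minus_equality) (use R that in \<open>auto simp: coord_ring_uminus\<close>)
      then show ?thesis using neg[OF that] by (simp add: a_inv_def)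
    qed
  qed (use R in auto)
  then show "ideal I (coord_ring n)"
    by (intro idealI coord.ring_axioms) (use R in \<open>auto simp: mult.commute\<close>)
qed

lemma ideal_coord_ringD:
  assumes "ideal I (coord_ring n)"
  shows ideal_subset: "I \<subseteq> carrier (coord_ring n)" and ideal_0: "0 \<in> I"
    and ideal_add: "p \<in> I \<Longrightarrow> q \<in> I \<Longrightarrow> p + q \<in> I"
    and ideal_mult: "r \<in> carrier (coord_ring n) \<Longrightarrow> p \<in> I \<Longrightarrow> r * p \<in> I"
  using assms by (auto simp: ideal_coord_ring_iff)

lemma ideal_uminus: "ideal I (coord_ring n) \<Longrightarrow> p \<in> I \<Longrightarrow> - p \<in> I"
  using ideal_mult[OF _ coord_ring_uminus[OF coord_ring_1], of I n p] by simp

lemma ideal_diff: "ideal I (coord_ring n) \<Longrightarrow> p \<in> I \<Longrightarrow> q \<in> I \<Longrightarrow> p - q \<in> I"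
  using ideal_add[of I n p "- q"] ideal_uminus[of I n q] by simp

lemma ideal_scale: "ideal I (coord_ring n) \<Longrightarrow> p \<in> I \<Longrightarrow> scale a p \<in> I"
  unfolding scale_def by (intro ideal_mult) (auto intro: coord_ring_single)

lemma ideal_sum: "ideal I (coord_ring n) \<Longrightarrow> (\<And>x. x \<in> A \<Longrightarrow> f x \<in> I) \<Longrightarrow> sum f A \<in> I"
  by (induction A rule: infinite_finite_induct) (auto intro: ideal_0 ideal_add)

lemma genideal_insert:
  assumes "f \<in> carrier (coord_ring n)" "A \<subseteq> carrier (coord_ring n)"
  shows "genideal (coord_ring n) (insert f A)
    = {i + f * g | i g. i \<in> genideal (coord_ring n) A \<and> g \<in> carrier (coord_ring n)}"
    (is "?L = ?R")
proof
  let ?I = "genideal (coord_ring n) A"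
  have I: "ideal ?I (coord_ring n)" and A: "A \<subseteq> ?I"
    using coord.genideal_ideal[OF assms(2)] coord.genideal_self[OF assms(2)] .
  have fA: "insert f A \<subseteq> carrier (coord_ring n)" using assms by simp
  have L: "ideal ?L (coord_ring n)" and fL: "insert f A \<subseteq> ?L"
    using coord.genideal_ideal[OF fA] coord.genideal_self[OF fA] .
  have "ideal ?R (coord_ring n)"
    unfolding ideal_coord_ring_iff
  proof (intro conjI ballI)
    show "?R \<subseteq> carrier (coord_ring n)"
      using ideal_subset[OF I] assms(1) by (auto intro!: coord_ring_add coord_ring_mult)
    show "0 \<in> ?R" using ideal_0[OF I] by (auto intro!: exI[of _ 0])
  next
    fix p q assume "p \<in> ?R" "q \<in> ?R"
    then obtain i g j h where
      *: "p = i + f * g" "q = j + f * h" "i \<in> ?I" "j \<in> ?I" "g \<in> carrier (coord_ring n)"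
        "h \<in> carrier (coord_ring n)"
      by blast
    have "p + q = (i + j) + f * (g + h)" using * by (simp add: algebra_simps)
    then show "p + q \<in> ?R" using ideal_add[OF I] coord_ring_add * by blast
  next
    fix p r :: "'a mpoly" assume "p \<in> ?R" and r: "r \<in> carrier (coord_ring n)"
    then obtain i g where
      *: "p = i + f * g" "i \<in> ?I" "g \<in> carrier (coord_ring n)" by blast
    have "r * p = r * i + f * (r * g)" using * by (simp add: algebra_simps)
    then show "r * p \<in> ?R" using ideal_mult[OF I r] coord_ring_mult[OF r] * by blast
  qed
  moreover have "insert f A \<subseteq> ?R"
  proof -
    have "f = 0 + f * 1" "\<And>a. a = a + f * 0" by simp_all
    then show ?thesis using A ideal_0[OF I] coord_ring_0 coord_ring_1 by blast
  qed
  ultimately show "?L \<subseteq> ?R" by (rule coord.genideal_minimal)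
  have "?I \<subseteq> ?L" using fL by (intro coord.genideal_minimal L) simp
  then show "?R \<subseteq> ?L"
    using fL assms(1) by (auto intro!: ideal_add[OF L] ideal_mult[OF L] simp: mult.commute[of f])
qed

definition graded_ideal :: "nat \<Rightarrow> 'k::field mpoly set \<Rightarrow> bool" where
  "graded_ideal n I \<longleftrightarrow> ideal I (coord_ring n) \<and> (\<forall>p\<in>I. \<forall>d. component d p \<in> I)"

lemma graded_idealD:
  assumes "graded_ideal n I"
  shows graded_ideal_ideal: "ideal I (coord_ring n)"
    and graded_ideal_component: "p \<in> I \<Longrightarrow> component d p \<in> I"
  using assms by (auto simp: graded_ideal_def)

text \<open>Multiplication by a homogeneous element only shifts components, and \<open>r\<close> is a sum of such elements.\<close>

lemma component_mult_in_ideal: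
  fixes p r :: "'k::field mpoly"
  assumes I: "ideal I (coord_ring n)" and p: "\<And>d. component d p \<in> I"
    and r: "r \<in> carrier (coord_ring n)"
  shows "component d (r * p) \<in> I"
proof -
  obtain N where N: "r = (\<Sum>e\<le>N. component e r)" by (rule sum_components)
  have "component d (r * p) = (\<Sum>e\<le>N. component d (component e r * p))"
    by (subst N) (simp add: sum_distrib_right component_sum)
  also have "\<dots> \<in> I"
    by (intro ideal_sum[OF I])
      (auto simp: component_mult_homogeneous[OF homogeneous_component] p
        intro!: ideal_0[OF I] ideal_mult[OF I] coord_ring_component r)
  finally show ?thesis .
qed

lemma graded_ideal_genideal:
  assumes "A \<subseteq> carrier (coord_ring n)" and hom: "\<And>p. p \<in> A \<Longrightarrow> \<exists>d. homogeneous d p"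
  shows "graded_ideal n (genideal (coord_ring n) A)"
proof -
  let ?I = "genideal (coord_ring n) A"
  have I: "ideal ?I (coord_ring n)" and A: "A \<subseteq> ?I"
    using coord.genideal_ideal[OF assms(1)] coord.genideal_self[OF assms(1)] .
  let ?J = "{p \<in> carrier (coord_ring n). \<forall>d. component d p \<in> ?I}"
  have "ideal ?J (coord_ring n)"
    unfolding ideal_coord_ring_iff
    using ideal_0[OF I] ideal_add[OF I] component_mult_in_ideal[OF I]
    by (auto simp: coord_ring_add coord_ring_mult component_add)
  moreover have "A \<subseteq> ?J"
  proof
    fix p assume p: "p \<in> A"
    obtain e where "homogeneous e p" using hom[OF p] ..
    then show "p \<in> ?J"
      using p assms(1) A ideal_0[OF I] by (auto simp: component_homogeneous)
  qed
  ultimately have "?I \<subseteq> ?J" by (rule coord.genideal_minimal)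
  then show ?thesis using I by (auto simp: graded_ideal_def)
qed

text \<open>Both descriptions of a homogeneous ideal are needed: generation by homogeneous elements is
  what complete intersections provide, closure under components is what makes arguments degree by
  degree possible.\<close>

lemma homogeneous_ideal_iff_graded: "homogeneous_ideal n I \<longleftrightarrow> graded_ideal n I"
proof
  assume h: "homogeneous_ideal n I"
  then have "I \<subseteq> carrier (coord_ring n)"
    unfolding homogeneous_ideal_def using ideal_subset by blast
  then have "graded_ideal n (genideal (coord_ring n) {p \<in> I. \<exists>d. homogeneous d p})"
    by (intro graded_ideal_genideal) auto
  then show "graded_ideal n I" using h unfolding homogeneous_ideal_def by metis
next
  assume g: "graded_ideal n I"
  let ?A = "{p \<in> I. \<exists>d. homogeneous d p}"
  note I = graded_ideal_ideal[OF g]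
  have A: "?A \<subseteq> carrier (coord_ring n)" using ideal_subset[OF I] by auto
  have "I \<subseteq> genideal (coord_ring n) ?A"
  proof
    fix p assume p: "p \<in> I"
    obtain N where N: "p = (\<Sum>e\<le>N. component e p)" by (rule sum_components)
    have "component e p \<in> genideal (coord_ring n) ?A" for e
      using coord.genideal_self[OF A] graded_ideal_component[OF g p] homogeneous_component by blast
    then show "p \<in> genideal (coord_ring n) ?A"
      by (subst N) (intro ideal_sum[OF coord.genideal_ideal[OF A]])
  qed
  moreover have "genideal (coord_ring n) ?A \<subseteq> I"
    by (intro coord.genideal_minimal I) auto
  ultimately show "homogeneous_ideal n I"
    using I by (auto simp: homogeneous_ideal_def)
qed

section \<open>Hilbert series of regular sequences\<close>

context vector_space
begin

text \<open>The ambient space is infinite-dimensional and \<open>dim\<close> is \<open>0\<close> on subspaces without a finite basis, so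
  monotonicity of \<open>dim\<close> depends on a finite spanning set.\<close>

lemma dim_le_if_subset_span:
  assumes "finite F" "V \<subseteq> U" "U \<subseteq> span F"
  shows "dim V \<le> dim U"
proof -
  obtain C where C: "C \<subseteq> U" "independent C" "U \<subseteq> span C" "card C = dim U"
    by (rule basis_exists)
  have "C \<subseteq> span F" using C assms by auto
  then have "finite C" using independent_span_bound[OF assms(1) C(2)] by simp
  then show ?thesis using dim_le_card[of V C] C assms by auto
qed

text \<open>The map \<open>\<phi>\<close> induces an isomorphism from \<open>V / U\<close> onto \<open>(W + \<phi> V) / W\<close>; comparing dimensions gives the
  equation. It is written without subtraction.\<close>

lemma dim_sum_linear_image:
  assumes add: "\<And>x y. \<phi> (x + y) = \<phi> x + \<phi> y" and scale: "\<And>c x. \<phi> (c *s x) = c *s \<phi> x"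
    and U: "subspace U" "U \<subseteq> V" and V: "subspace V" "finite F" "V \<subseteq> span F"
    and W: "subspace W" "finite G" "W \<subseteq> span G"
    and vimage: "\<And>v. v \<in> V \<Longrightarrow> \<phi> v \<in> W \<longleftrightarrow> v \<in> U"
  shows "dim {w + \<phi> v | w v. w \<in> W \<and> v \<in> V} + dim U = dim W + dim V"
proof -
  have \<phi>0: "\<phi> 0 = 0" using scale[of 0 0] by simp
  have \<phi>diff: "\<phi> (x - y) = \<phi> x - \<phi> y" for x y
    using add[of "x - y" y] by (simp add: algebra_simps)
  obtain B where B: "B \<subseteq> U" "independent B" "U \<subseteq> span B" "card B = dim U"
    by (rule basis_exists)
  have "B \<subseteq> V" using B U by auto
  then obtain B' where B': "B \<subseteq> B'" "B' \<subseteq> V" "independent B'" "V \<subseteq> span B'"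
    using maximal_independent_subset_extend[OF _ B(2)] by metis
  obtain D where D: "D \<subseteq> W" "independent D" "W \<subseteq> span D" "card D = dim W"
    by (rule basis_exists)
  have fin: "finite B'" "finite D"
    using independent_span_bound[OF V(2) B'(3)] independent_span_bound[OF W(2) D(2)] B' V D W
    by auto
  have spanD: "span D = W" using D W span_subspace by blast
  have span: "\<exists>w\<in>W. \<exists>s\<in>span C. x = w + \<phi> s" if x: "x \<in> span (D \<union> \<phi> ` C)" for x C
  proof -
    let ?T = "{w + \<phi> s | w s. w \<in> W \<and> s \<in> span C}"
    have "subspace ?T"
      unfolding subspace_def
    proof (intro conjI ballI allI)
      show "0 \<in> ?T" using \<phi>0 subspace_0[OF W(1)] span_zero[of C]
        by (metis (mono_tags, lifting) add_0 mem_Collect_eq)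
    next
      fix x y assume "x \<in> ?T" "y \<in> ?T"
      then obtain w s w' s' where *: "x = w + \<phi> s" "y = w' + \<phi> s'" "w \<in> W" "w' \<in> W"
        "s \<in> span C" "s' \<in> span C" by blast
      have "x + y = (w + w') + \<phi> (s + s')" using * by (simp add: add algebra_simps)
      then show "x + y \<in> ?T" using * subspace_add[OF W(1)] span_add by blast
    next
      fix c x assume "x \<in> ?T"
      then obtain w s where *: "x = w + \<phi> s" "w \<in> W" "s \<in> span C" by blast
      have "c *s x = c *s w + \<phi> (c *s s)" using * by (simp add: scale scale_right_distrib)
      then show "c *s x \<in> ?T" using * subspace_scale[OF W(1)] span_scale by blast
    qed
    moreover have "D \<union> \<phi> ` C \<subseteq> ?T"
    proof -
      have "w = w + \<phi> 0" "\<phi> s = 0 + \<phi> s" for w s using \<phi>0 by simp_all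
      then show ?thesis using D(1) subspace_0[OF W(1)] span_zero[of C] span_base[of _ C] by blast
    qed
    ultimately have "span (D \<union> \<phi> ` C) \<subseteq> ?T" by (intro span_minimal)
    then show ?thesis using x by blast
  qed
  \<comment> \<open>A basis of \<open>W\<close> stays independent when the images of the basis vectors of \<open>V\<close> outside \<open>U\<close> are
    adjoined: a relation \<open>\<phi> c = w + \<phi> s\<close> forces \<open>c - s\<close> into \<open>U\<close>.\<close>
  have indep: "independent (D \<union> \<phi> ` C) \<and> card (D \<union> \<phi> ` C) = card D + card C"
    if "C \<subseteq> B' - B" for C
  proof -
    have "finite C" using that fin finite_subset by blast
    then show ?thesis using that
    proof (induction C)
      case empty
      then show ?case using D by simp
    next
      case (insert c C)
      have c: "c \<in> V" "c \<notin> span (B \<union> C)"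
      proof -
        show "c \<in> V" using insert B' by auto
        have "insert c (B \<union> C) \<subseteq> B'" using insert B' by auto
        then have "independent (insert c (B \<union> C))" using B' independent_mono by blast
        then show "c \<notin> span (B \<union> C)" using insert by (auto simp: independent_insert split: if_splits)
      qed
      have "\<phi> c \<notin> span (D \<union> \<phi> ` C)"
      proof
        assume "\<phi> c \<in> span (D \<union> \<phi> ` C)"
        then obtain w s where ws: "w \<in> W" "s \<in> span C" "\<phi> c = w + \<phi> s"
          using span by blast
        have "C \<subseteq> V" using insert B' by auto
        then have "s \<in> V" using ws V(1) span_minimal by blast
        then have "c - s \<in> V" using c subspace_diff[OF V(1)] by blast
        moreover have "\<phi> (c - s) \<in> W" using ws by (simp add: \<phi>diff)
        ultimately have "c - s \<in> span B" using vimage B by blast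
        then have "(c - s) + s \<in> span (B \<union> C)"
          using ws span_mono[of B "B \<union> C"] span_mono[of C "B \<union> C"]
          by (intro span_add) auto
        then show False using c by simp
      qed
      then show ?case
        using insert fin span_superset[of "D \<union> \<phi> ` C"] by (auto simp: independent_insert)
    qed
  qed
  let ?E = "D \<union> \<phi> ` (B' - B)" and ?X = "{w + \<phi> v | w v. w \<in> W \<and> v \<in> V}"
  have "?E \<subseteq> ?X"
  proof -
    have "w = w + \<phi> 0" "\<phi> s = 0 + \<phi> s" for w s using \<phi>0 by simp_all
    then show ?thesis using D(1) B' subspace_0[OF W(1)] subspace_0[OF V(1)] by blast
  qed
  moreover have "?X \<subseteq> span ?E"
  proof -
    have "subspace {v. \<phi> v \<in> span ?E}"
      by (auto simp: subspace_def \<phi>0 add scale span_zero span_add span_scale)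
    moreover have "B' \<subseteq> {v. \<phi> v \<in> span ?E}"
    proof
      fix b assume "b \<in> B'"
      show "b \<in> {v. \<phi> v \<in> span ?E}"
      proof (cases "b \<in> B")
        case True
        then have "\<phi> b \<in> span D" using B U vimage spanD by auto
        then show ?thesis using span_mono[of D ?E] by auto
      next
        case False
        then show ?thesis using \<open>b \<in> B'\<close> by (auto intro: span_base)
      qed
    qed
    ultimately have "span B' \<subseteq> {v. \<phi> v \<in> span ?E}" by (intro span_minimal)
    then have "\<phi> v \<in> span ?E" if "v \<in> V" for v using B' that by auto
    moreover have "w \<in> span ?E" if "w \<in> W" for w using that spanD span_mono[of D ?E] by auto
    ultimately show ?thesis by (auto intro: span_add)
  qed
  ultimately have "dim ?X = card ?E"
    using indep[of "B' - B"] by (intro dim_unique[OF _ _ _ refl]) auto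
  moreover have "card ?E = card D + card (B' - B)" using indep by blast
  moreover have "card B' = card B + card (B' - B)"
    using fin B' by (metis card_Diff_subset card_mono finite_subset le_add_diff_inverse)
  moreover have "dim V = card B'" using B' by (metis basis_card_eq_dim)
  ultimately show ?thesis using B D by simp
qed

end

interpretation mpoly: vector_space "scale :: 'k::field \<Rightarrow> 'k mpoly \<Rightarrow> 'k mpoly"
  by (rule vector_space_scale)

definition degree_part :: "nat \<Rightarrow> 'k::field mpoly set \<Rightarrow> 'k mpoly set" where
  "degree_part d I = {p \<in> I. homogeneous d p}"

lemma hilbert_function_eq:
  fixes I :: "'k::field mpoly set"
  shows "hilbert_function n I d =
    mpoly.dim (degree_part d (carrier (coord_ring n) :: 'k mpoly set)) - mpoly.dim (degree_part d I)"
  by (simp add: hilbert_function_def degree_part_def)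

lemma subspace_degree_part:
  "ideal I (coord_ring n) \<Longrightarrow> mpoly.subspace (degree_part d I)"
  by (auto simp: mpoly.subspace_def degree_part_def homogeneous_add homogeneous_scale
      intro: ideal_add ideal_0 ideal_scale)

lemma ideal_coord_ring: "ideal (carrier (coord_ring n)) (coord_ring n)"
  by (rule coord.oneideal)

lemma degree_part_finite_span:
  obtains F :: "'k::field mpoly set"
  where "finite F" "degree_part d (carrier (coord_ring n)) \<subseteq> mpoly.span F"
proof
  let ?M = "{m. Poly_Mapping.keys m \<subseteq> {..n} \<and> monom_degree m = d}"
  let ?F = "(\<lambda>m. Poly_Mapping.single m 1) ` ?M :: 'k mpoly set"
  show "finite ?F" using finite_monomials by blast
  show "degree_part d (carrier (coord_ring n)) \<subseteq> mpoly.span ?F"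
  proof
    fix p :: "'k mpoly" assume p: "p \<in> degree_part d (carrier (coord_ring n))"
    have "scale (Poly_Mapping.lookup p m) (Poly_Mapping.single m 1) \<in> mpoly.span ?F"
      if "m \<in> Poly_Mapping.keys p" for m
      using p that
      by (intro mpoly.span_scale mpoly.span_base)
        (auto simp: degree_part_def in_coord_ring_iff homogeneous_def)
    then have "(\<Sum>m\<in>Poly_Mapping.keys p. Poly_Mapping.single m (Poly_Mapping.lookup p m)) \<in> mpoly.span ?F"
      by (intro mpoly.span_sum) (simp add: scale_def mult_single)
    then show "p \<in> mpoly.span ?F" by (simp add: sum_single_keys)
  qed
qed

lemma dim_degree_part_mono:
  assumes "I \<subseteq> J" "J \<subseteq> carrier (coord_ring n)"
  shows "mpoly.dim (degree_part d I) \<le> mpoly.dim (degree_part d J)"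
proof -
  obtain F :: "'a mpoly set" where F: "finite F" "degree_part d (carrier (coord_ring n)) \<subseteq> mpoly.span F"
    by (rule degree_part_finite_span)
  show ?thesis
    by (rule mpoly.dim_le_if_subset_span[OF F(1)]) (use F assms in \<open>auto simp: degree_part_def\<close>)
qed

lemma hilbert_function_antimono:
  assumes "I \<subseteq> J" "J \<subseteq> carrier (coord_ring n)"
  shows "hilbert_function n J d \<le> hilbert_function n I d"
  unfolding hilbert_function_eq by (intro diff_le_mono2 dim_degree_part_mono[OF assms])

text \<open>This is the exact sequence \<open>0 \<rightarrow> (S/I)(-a) \<rightarrow> S/I \<rightarrow> S/(I + f S) \<rightarrow> 0\<close> in degree \<open>d\<close>, where the first map
  is multiplication by \<open>f\<close>. The conditional covers the degrees below \<open>a\<close>, in which the shifted module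
  vanishes.\<close>

lemma hilbert_function_add_nonzerodivisor:
  fixes I :: "'k::field mpoly set"
  assumes I: "graded_ideal n I" and f: "f \<in> carrier (coord_ring n)" "homogeneous a f"
    and reg: "\<And>g. g \<in> carrier (coord_ring n) \<Longrightarrow> f * g \<in> I \<Longrightarrow> g \<in> I"
  shows "hilbert_function n {i + f * g | i g. i \<in> I \<and> g \<in> carrier (coord_ring n)} d
      + (if a \<le> d then hilbert_function n I (d - a) else 0) = hilbert_function n I d"
proof -
  let ?S = "carrier (coord_ring n) :: 'k mpoly set" and ?J = "{i + f * g | i g. i \<in> I \<and> g \<in> carrier (coord_ring n)}"
  note I' = graded_ideal_ideal[OF I]
  have IS: "I \<subseteq> ?S" using ideal_subset[OF I'] .
  have JS: "?J \<subseteq> ?S" using f IS by (auto intro!: coord_ring_add coord_ring_mult)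
  have comp: "\<exists>i g. p = i + f * g \<and> i \<in> degree_part d I \<and> g \<in> degree_part (d - a) ?S \<and> (\<not> a \<le> d \<longrightarrow> g = 0)"
    if "p \<in> degree_part d ?J" for p
  proof -
    obtain i g where p: "p = i + f * g" "i \<in> I" "g \<in> ?S" "homogeneous d p"
      using \<open>p \<in> degree_part d ?J\<close> by (auto simp: degree_part_def)
    have "p = component d p" using p component_homogeneous[OF p(4), of d] by simp
    also have "\<dots> = component d i + f * (if a \<le> d then component (d - a) g else 0)"
      using p component_mult_homogeneous[OF f(2)] by (simp add: component_add)
    finally show ?thesis
      using graded_ideal_component[OF I p(2)] coord_ring_component[OF p(3)]
      by (intro exI conjI) (auto simp: degree_part_def)
  qed
  show ?thesis
  proof (cases "a \<le> d")
    case False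
    have "degree_part d ?J = degree_part d I"
    proof
      show "degree_part d ?J \<subseteq> degree_part d I" using comp False by fastforce
      have "i = i + f * 0" for i by simp
      then show "degree_part d I \<subseteq> degree_part d ?J"
        unfolding degree_part_def using coord_ring_0 by blast
    qed
    then show ?thesis using False by (simp add: hilbert_function_eq)
  next
    case True
    let ?W = "degree_part d I" and ?V = "degree_part (d - a) ?S" and ?U = "degree_part (d - a) I"
    have eq: "degree_part d ?J = {w + f * v | w v. w \<in> ?W \<and> v \<in> ?V}" (is "_ = ?X")
    proof
      show "degree_part d ?J \<subseteq> ?X" using comp by blast
      have "homogeneous d (f * v)" if "homogeneous (d - a) v" for v
        using homogeneous_mult[OF f(2) that] True by simp
      then show "?X \<subseteq> degree_part d ?J"
        by (auto simp: degree_part_def intro!: homogeneous_add)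
    qed
    obtain F :: "'k mpoly set" where F: "finite F" "?V \<subseteq> mpoly.span F"
      by (rule degree_part_finite_span)
    obtain G :: "'k mpoly set" where G: "finite G" "degree_part d ?S \<subseteq> mpoly.span G"
      by (rule degree_part_finite_span)
    have "mpoly.dim ?X + mpoly.dim ?U = mpoly.dim ?W + mpoly.dim ?V"
    proof (rule mpoly.dim_sum_linear_image[where \<phi> = "(*) f"])
      show "mpoly.subspace ?U" "mpoly.subspace ?W" by (rule subspace_degree_part[OF I'])+
      show "mpoly.subspace ?V" by (rule subspace_degree_part[OF ideal_coord_ring])
      show "?U \<subseteq> ?V" using IS by (auto simp: degree_part_def)
      show "finite F" "?V \<subseteq> mpoly.span F" "finite G" using F G by auto
      show "?W \<subseteq> mpoly.span G" using G IS by (auto simp: degree_part_def)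
      show "f * v \<in> ?W \<longleftrightarrow> v \<in> ?U" if "v \<in> ?V" for v
        using that homogeneous_mult[OF f(2), of "d - a" v] reg ideal_mult[OF I' f(1)] True
        by (auto simp: degree_part_def)
    qed (simp_all add: algebra_simps scale_def)
    then have "mpoly.dim (degree_part d ?J) + mpoly.dim ?U = mpoly.dim ?W + mpoly.dim ?V"
      using eq by simp
    moreover have "mpoly.dim (degree_part d ?J) \<le> mpoly.dim (degree_part d ?S)"
      by (rule dim_degree_part_mono[OF JS order_refl])
    moreover have "mpoly.dim ?U \<le> mpoly.dim ?V" by (rule dim_degree_part_mono[OF IS order_refl])
    moreover have "mpoly.dim ?W \<le> mpoly.dim (degree_part d ?S)" by (rule dim_degree_part_mono[OF IS order_refl])
    ultimately show ?thesis using True by (simp add: hilbert_function_eq)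
  qed
qed

definition hilbert_series :: "nat \<Rightarrow> 'k::field mpoly set \<Rightarrow> rat fps" where
  "hilbert_series n I = Abs_fps (\<lambda>d. of_nat (hilbert_function n I d))"

lemma hilbert_series_add_nonzerodivisor:
  assumes I: "graded_ideal n I" and f: "f \<in> carrier (coord_ring n)" "homogeneous a f"
    and reg: "\<And>g. g \<in> carrier (coord_ring n) \<Longrightarrow> f * g \<in> I \<Longrightarrow> g \<in> I"
  shows "hilbert_series n {i + f * g | i g. i \<in> I \<and> g \<in> carrier (coord_ring n)}
      = hilbert_series n I * (1 - fps_X ^ a)"
proof (rule fps_ext)
  fix d
  show "fps_nth (hilbert_series n {i + f * g | i g. i \<in> I \<and> g \<in> carrier (coord_ring n)}) d
      = fps_nth (hilbert_series n I * (1 - fps_X ^ a)) d"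
    using arg_cong[OF hilbert_function_add_nonzerodivisor[OF assms, of d], of "of_nat :: nat \<Rightarrow> rat"]
    by (auto simp: hilbert_series_def right_diff_distrib fps_X_power_mult_right_nth split: if_splits)
qed

text \<open>The Hilbert series of the coordinate ring itself is left open here: \<open>hilbert_series_coord_ring\<close>
  determines it by applying this lemma to the sequence of all variables.\<close>

lemma hilbert_series_regular_sequence_relative:
  fixes fs :: "'k::field mpoly list"
  assumes fs: "regular_sequence n fs" and hom: "list_all2 homogeneous as fs"
  shows "hilbert_series n (genideal (coord_ring n) (set fs))
      = hilbert_series n (genideal (coord_ring n) {} :: 'k mpoly set) * prod_list (map (\<lambda>a. 1 - fps_X ^ a) as)"
proof -
  have len: "length as = length fs" using hom by (rule list_all2_lengthD)
  have S: "set fs \<subseteq> carrier (coord_ring n)" using fs by (simp add: regular_sequence_def)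
  have "hilbert_series n (genideal (coord_ring n) (set (take i fs)))
      = hilbert_series n (genideal (coord_ring n) {} :: 'k mpoly set) * prod_list (map (\<lambda>a. 1 - fps_X ^ a) (take i as))"
    if "i \<le> length fs" for i
    using that
  proof (induction i)
    case (Suc i)
    let ?I = "genideal (coord_ring n) (set (take i fs))"
    have i: "i < length fs" "i < length as" using Suc len by auto
    have take_S: "set (take i fs) \<subseteq> carrier (coord_ring n)" using S set_take_subset[of i fs] by blast
    have "fs ! i \<in> carrier (coord_ring n)" "homogeneous (as ! i) (fs ! i)"
      using i S hom by (auto simp: list_all2_conv_all_nth)
    moreover have "graded_ideal n ?I"
    proof (rule graded_ideal_genideal[OF take_S])
      fix p assume "p \<in> set (take i fs)"
      then obtain j where "j < length fs" "p = fs ! j"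
        by (metis in_set_conv_nth in_set_takeD)
      then show "\<exists>d. homogeneous d p" using hom by (auto simp: list_all2_conv_all_nth)
    qed
    moreover have "g \<in> ?I" if "g \<in> carrier (coord_ring n)" "fs ! i * g \<in> ?I" for g
      using fs that i by (auto simp: regular_sequence_def)
    moreover have "set (take (Suc i) fs) = insert (fs ! i) (set (take i fs))"
      using i by (simp add: take_Suc_conv_app_nth)
    ultimately have "hilbert_series n (genideal (coord_ring n) (set (take (Suc i) fs)))
        = hilbert_series n ?I * (1 - fps_X ^ (as ! i))"
      by (simp add: genideal_insert[OF _ take_S] hilbert_series_add_nonzerodivisor)
    then show ?case
      using Suc i by (simp add: take_Suc_conv_app_nth mult.assoc)
  qed simp
  from this[of "length fs"] show ?thesis using len by simp
qed

section \<open>Ideals generated by powers of variables\<close>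

text \<open>The ideal \<open>(x\<^sub>i^a\<^sub>i)\<close>, described by its monomials instead of its generators. Regularity,
  saturation and primality then become conditions on exponents.\<close>

definition power_ideal :: "nat \<Rightarrow> nat list \<Rightarrow> 'k::field mpoly set" where
  "power_ideal n as = {p \<in> carrier (coord_ring n).
     \<forall>m\<in>Poly_Mapping.keys p. \<exists>i<length as. as ! i \<le> Poly_Mapping.lookup m i}"

definition variable_powers :: "nat list \<Rightarrow> 'k::field mpoly list" where
  "variable_powers as = map (\<lambda>i. variable i ^ (as ! i)) [0..<length as]"

lemma set_variable_powers: "set (variable_powers as) = {variable i ^ (as ! i) | i. i < length as}"
  by (auto simp: variable_powers_def)

lemma length_variable_powers [simp]: "length (variable_powers as) = length as"
  by (simp add: variable_powers_def)

lemma nth_variable_powers [simp]: "i < length as \<Longrightarrow> variable_powers as ! i = variable i ^ (as ! i)"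
  by (simp add: variable_powers_def)

lemma take_variable_powers: "take i (variable_powers as) = variable_powers (take i as)"
  by (rule nth_equalityI) auto

lemma homogeneous_variable_powers: "list_all2 homogeneous as (variable_powers as)"
  by (simp add: list_all2_conv_all_nth homogeneous_variable_power)

lemma set_variable_powers_subset:
  "length as \<le> Suc n \<Longrightarrow> set (variable_powers as) \<subseteq> carrier (coord_ring n)"
  by (auto simp: set_variable_powers intro!: coord_ring_variable_power)

lemma ideal_power_ideal: "ideal (power_ideal n as :: 'k::field mpoly set) (coord_ring n)"
  unfolding ideal_coord_ring_iff
proof (intro conjI ballI)
  fix p q :: "'k mpoly" assume "p \<in> power_ideal n as" "q \<in> power_ideal n as"
  then show "p + q \<in> power_ideal n as"
    using Poly_Mapping.keys_add[of p q] by (auto simp: power_ideal_def coord_ring_add)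
next
  fix p r :: "'k mpoly" assume p: "p \<in> power_ideal n as" and r: "r \<in> carrier (coord_ring n)"
  have "\<exists>i<length as. as ! i \<le> Poly_Mapping.lookup m i"
    if m: "m \<in> Poly_Mapping.keys (r * p)" for m
  proof -
    obtain u v where "m = u + v" "v \<in> Poly_Mapping.keys p"
      using subsetD[OF keys_mult m] by blast
    then show ?thesis using p by (force simp: power_ideal_def lookup_add)
  qed
  then show "r * p \<in> power_ideal n as" using p r by (auto simp: power_ideal_def coord_ring_mult)
qed (auto simp: power_ideal_def)

lemma graded_power_ideal: "graded_ideal n (power_ideal n as)"
  using keys_component ideal_power_ideal
  by (fastforce simp: graded_ideal_def power_ideal_def coord_ring_component)

lemma genideal_variable_powers:
  assumes "length as \<le> Suc n"
  shows "genideal (coord_ring n) (set (variable_powers as)) = (power_ideal n as :: 'k::field mpoly set)"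
proof
  let ?A = "set (variable_powers as) :: 'k mpoly set" and ?I = "genideal (coord_ring n) (set (variable_powers as)) :: 'k mpoly set"
  note A = set_variable_powers_subset[OF assms, where 'a='k]
  have "?A \<subseteq> power_ideal n as"
    using A by (auto simp: power_ideal_def set_variable_powers variable_power)
  then show "?I \<subseteq> power_ideal n as" by (rule coord.genideal_minimal[OF ideal_power_ideal])
  note I = coord.genideal_ideal[OF A]
  show "power_ideal n as \<subseteq> ?I"
  proof
    fix p :: "'k mpoly" assume p: "p \<in> power_ideal n as"
    have "Poly_Mapping.single m (Poly_Mapping.lookup p m) \<in> ?I" if m: "m \<in> Poly_Mapping.keys p" for m
    proof -
      obtain i where i: "i < length as" "as ! i \<le> Poly_Mapping.lookup m i"
        using p m by (auto simp: power_ideal_def)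
      let ?s = "Poly_Mapping.single i (as ! i)"
      have s: "(m - ?s) + ?s = m"
        using i by (intro poly_mapping_eqI) (auto simp: lookup_add lookup_minus lookup_single when_def)
      have "Poly_Mapping.keys m \<subseteq> {..n}"
        using p m by (auto simp: power_ideal_def in_coord_ring_iff)
      moreover have "Poly_Mapping.keys (m - ?s) \<subseteq> Poly_Mapping.keys m"
        by (auto simp: in_keys_iff lookup_minus)
      ultimately have "Poly_Mapping.single (m - ?s) (Poly_Mapping.lookup p m) \<in> carrier (coord_ring n)"
        by (intro coord_ring_single) auto
      moreover have "variable i ^ (as ! i) \<in> ?I"
        using coord.genideal_self[OF A] i by (auto simp: set_variable_powers)
      ultimately have "Poly_Mapping.single (m - ?s) (Poly_Mapping.lookup p m) * variable i ^ (as ! i) \<in> ?I"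
        by (rule ideal_mult[OF I])
      then show ?thesis by (simp add: variable_power mult_single s)
    qed
    then have "(\<Sum>m\<in>Poly_Mapping.keys p. Poly_Mapping.single m (Poly_Mapping.lookup p m)) \<in> ?I"
      by (intro ideal_sum[OF I])
    then show "p \<in> ?I" by (simp add: sum_single_keys)
  qed
qed

text \<open>Multiplication by \<open>x\<^sub>i\<close> with \<open>i \<ge> length as\<close> leaves the exponents that decide membership unchanged.
  This yields both the regularity of the sequence \<open>x\<^sub>i^a\<^sub>i\<close> and the saturation of the ideal.\<close>

lemma power_ideal_cancel_variable:
  assumes "length as \<le> i" "p \<in> carrier (coord_ring n)" "variable i ^ e * p \<in> power_ideal n as"
  shows "p \<in> power_ideal n as"
proof -
  have "\<exists>j<length as. as ! j \<le> Poly_Mapping.lookup m j" if "m \<in> Poly_Mapping.keys p" for m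
  proof -
    have "Poly_Mapping.single i e + m \<in> Poly_Mapping.keys (variable i ^ e * p)"
      using that by (simp add: keys_variable_power_times)
    then obtain j where "j < length as" "as ! j \<le> Poly_Mapping.lookup (Poly_Mapping.single i e + m) j"
      using assms(3) by (auto simp: power_ideal_def)
    then show ?thesis using assms(1) by (auto simp: lookup_add lookup_single)
  qed
  then show ?thesis using assms(2) by (auto simp: power_ideal_def)
qed

lemma one_notin_power_ideal: "\<forall>a\<in>set as. 0 < a \<Longrightarrow> 1 \<notin> power_ideal n as"
  by (auto simp: power_ideal_def)

lemma regular_sequence_variable_powers:
  assumes "length as \<le> Suc n" "\<forall>a\<in>set as. 0 < a"
  shows "regular_sequence n (variable_powers as :: 'k::field mpoly list)"
proof -
  have "g \<in> power_ideal n (take i as)"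
    if "i < length as" "g \<in> carrier (coord_ring n)" "variable i ^ (as ! i) * g \<in> power_ideal n (take i as)"
    for i and g :: "'k mpoly"
    by (rule power_ideal_cancel_variable[OF _ that(2,3)]) simp
  moreover have "genideal (coord_ring n) (set (take i (variable_powers as :: 'k mpoly list)))
      = power_ideal n (take i as)" for i
    using assms(1) by (simp add: take_variable_powers genideal_variable_powers)
  moreover have "genideal (coord_ring n) (set (variable_powers as :: 'k mpoly list)) \<noteq> carrier (coord_ring n)"
    using genideal_variable_powers[OF assms(1), where 'k='k] one_notin_power_ideal[OF assms(2)] coord_ring_1
    by metis
  ultimately show ?thesis
    using set_variable_powers_subset[OF assms(1)] unfolding regular_sequence_def by simp
qed

definition variable_ideal :: "nat \<Rightarrow> nat \<Rightarrow> 'k::field mpoly set" where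
  "variable_ideal n j = power_ideal n (replicate j 1)"

lemma mem_variable_ideal_iff:
  "p \<in> variable_ideal n j \<longleftrightarrow> p \<in> carrier (coord_ring n) \<and>
     (\<forall>m\<in>Poly_Mapping.keys p. \<exists>i<j. 0 < Poly_Mapping.lookup m i)"
  by (simp add: variable_ideal_def power_ideal_def Suc_le_eq cong: conj_cong)

text \<open>The quotient by all variables is the ground field, placed in degree \<open>0\<close>.\<close>

lemma hilbert_series_irrelevant_ideal:
  "hilbert_series n (variable_ideal n (Suc n) :: 'k::field mpoly set) = 1"
proof (rule fps_ext)
  fix d
  let ?I = "variable_ideal n (Suc n) :: 'k mpoly set"
  have mem: "p \<in> ?I \<longleftrightarrow> p \<in> carrier (coord_ring n) \<and> 0 \<notin> Poly_Mapping.keys p" for p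
  proof -
    have "(\<exists>i<Suc n. 0 < Poly_Mapping.lookup m i) \<longleftrightarrow> m \<noteq> 0" if "Poly_Mapping.keys m \<subseteq> {..n}" for m :: "nat \<Rightarrow>\<^sub>0 nat"
    proof
      assume "m \<noteq> 0"
      then obtain i where "i \<in> Poly_Mapping.keys m" by (metis all_not_in_conv keys_eq_empty)
      moreover from this have "i < Suc n" using that by (auto simp: less_Suc_eq_le)
      ultimately show "\<exists>i<Suc n. 0 < Poly_Mapping.lookup m i"
        by (intro exI[of _ i]) (auto simp: in_keys_iff)
    qed auto
    then show ?thesis
      unfolding mem_variable_ideal_iff in_coord_ring_iff by (metis (no_types, lifting))
  qed
  have "hilbert_function n ?I d = (if d = 0 then 1 else 0)"
  proof (cases "d = 0")
    case False
    have "degree_part d ?I = degree_part d (carrier (coord_ring n))"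
      using False monom_degree_eq_0_iff[of 0] by (auto simp: degree_part_def mem homogeneous_def)
    then show ?thesis using False by (simp add: hilbert_function_eq)
  next
    case True
    have "degree_part 0 ?I = {0}"
    proof
      show "degree_part 0 ?I \<subseteq> {0}"
      proof
        fix p assume "p \<in> degree_part 0 ?I"
        then have "0 \<notin> Poly_Mapping.keys p" "\<forall>m\<in>Poly_Mapping.keys p. m = 0"
          by (simp_all add: degree_part_def mem homogeneous_def monom_degree_eq_0_iff)
        then have "Poly_Mapping.keys p = {}" by (metis all_not_in_conv)
        then show "p \<in> {0}" by simp
      qed
      show "{0} \<subseteq> degree_part 0 ?I" by (auto simp: degree_part_def mem)
    qed
    then have I0: "mpoly.dim (degree_part 0 ?I) = 0"
      using mpoly.dim_le_card[of "{0}" "{}"] by simp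
    have "degree_part 0 (carrier (coord_ring n)) \<subseteq> mpoly.span {1 :: 'k mpoly}"
    proof
      fix p :: "'k mpoly" assume "p \<in> degree_part 0 (carrier (coord_ring n))"
      then have "Poly_Mapping.keys p \<subseteq> {0}"
        by (auto simp: degree_part_def homogeneous_def monom_degree_eq_0_iff)
      then have "p = scale (Poly_Mapping.lookup p 0) 1"
        by (intro poly_mapping_eqI) (auto simp: lookup_scale lookup_one when_def in_keys_iff)
      then show "p \<in> mpoly.span {1}" by (metis mpoly.span_base mpoly.span_scale singletonI)
    qed
    moreover have "mpoly.independent {1 :: 'k mpoly}"
      using mpoly.independent_insert[of 1 "{}"] by (simp add: mpoly.independent_empty)
    ultimately have "mpoly.dim (degree_part 0 (carrier (coord_ring n)) :: 'k mpoly set) = 1"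
      by (intro mpoly.dim_unique[of "{1}"])
        (auto simp: degree_part_def homogeneous_def monom_degree_def)
    then show ?thesis using True I0 by (simp add: hilbert_function_eq)
  qed
  then show "fps_nth (hilbert_series n ?I) d = fps_nth 1 d" by (simp add: hilbert_series_def)
qed

text \<open>Counting monomials is avoided: \<open>x\<^sub>0, \<dots>, x\<^sub>n\<close> is a regular sequence of \<open>n + 1\<close> linear forms whose
  quotient has Hilbert series \<open>1\<close>.\<close>

lemma hilbert_series_coord_ring:
  "hilbert_series n (genideal (coord_ring n) {} :: 'k::field mpoly set) * (1 - fps_X) ^ Suc n = 1"
proof -
  let ?as = "replicate (Suc n) (1::nat)"
  have "hilbert_series n (power_ideal n ?as :: 'k mpoly set)
     = hilbert_series n (genideal (coord_ring n) {} :: 'k mpoly set) * prod_list (map (\<lambda>a. 1 - fps_X ^ a) ?as)"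
    using hilbert_series_regular_sequence_relative[OF regular_sequence_variable_powers
        homogeneous_variable_powers, of ?as n, where 'k='k]
      genideal_variable_powers[of ?as n, where 'k='k] by (simp del: replicate_Suc)
  then show ?thesis
    by (simp only: hilbert_series_irrelevant_ideal flip: variable_ideal_def) simp
qed

lemma hilbert_series_regular_sequence:
  fixes fs :: "'k::field mpoly list"
  assumes "regular_sequence n fs" and "list_all2 homogeneous as fs"
  shows "hilbert_series n (genideal (coord_ring n) (set fs)) * (1 - fps_X) ^ Suc n
      = prod_list (map (\<lambda>a. 1 - fps_X ^ a) as)"
proof -
  let ?G = "hilbert_series n (genideal (coord_ring n) {} :: 'k mpoly set)"
  have "hilbert_series n (genideal (coord_ring n) (set fs)) * (1 - fps_X) ^ Suc n
      = (?G * (1 - fps_X) ^ Suc n) * prod_list (map (\<lambda>a. 1 - fps_X ^ a) as)"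
    unfolding hilbert_series_regular_sequence_relative[OF assms] by (simp only: mult_ac)
  then show ?thesis unfolding hilbert_series_coord_ring by simp
qed

section \<open>Codimension\<close>

lemma graded_variable_ideal: "graded_ideal n (variable_ideal n j)"
  by (simp add: variable_ideal_def graded_power_ideal)

lemma variable_mem_variable_ideal_iff:
  "i \<le> n \<Longrightarrow> variable i \<in> variable_ideal n j \<longleftrightarrow> i < j"
  using coord_ring_variable_power[of i n 1]
  by (auto simp: mem_variable_ideal_iff variable_def lookup_single when_def)

lemma variable_ideal_eq_genideal:
  assumes "j \<le> Suc n"
  shows "variable_ideal n j = genideal (coord_ring n) (variable ` {..<j} :: 'k::field mpoly set)"
proof -
  have "variable_powers (replicate j 1) = (map variable [0..<j] :: 'k mpoly list)"
    by (rule nth_equalityI) simp_all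
  then have "set (variable_powers (replicate j 1)) = (variable ` {..<j} :: 'k mpoly set)"
    by (simp add: atLeast0LessThan)
  then show ?thesis
    using genideal_variable_powers[of "replicate j 1" n, where 'k='k] assms
    by (simp add: variable_ideal_def)
qed

text \<open>Modulo \<open>x\<^sub>0, \<dots>, x\<^sub>j\<^sub>-\<^sub>1\<close> every polynomial is congruent to its part free of these variables, and the
  product of two nonzero polynomials free of them is again nonzero and free of them.\<close>

lemma primeideal_variable_ideal:
  "primeideal (variable_ideal n j :: 'k::field mpoly set) (coord_ring n)"
proof (rule primeidealI)
  let ?Q = "variable_ideal n j :: 'k mpoly set"
  show Q: "ideal ?Q (coord_ring n)" using graded_variable_ideal by (rule graded_ideal_ideal)
  show "cring (coord_ring n)" by (rule cring_coord_ring)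
  have "1 \<notin> ?Q" by (simp add: mem_variable_ideal_iff)
  then show "carrier (coord_ring n) \<noteq> ?Q" using coord_ring_1 by blast
  fix a b :: "'k mpoly"
  assume a: "a \<in> carrier (coord_ring n)" and b: "b \<in> carrier (coord_ring n)"
    and "a \<otimes>\<^bsub>coord_ring n\<^esub> b \<in> ?Q"
  then have ab: "a * b \<in> ?Q" by simp
  define P where "P m \<longleftrightarrow> (\<exists>i<j. 0 < Poly_Mapping.lookup m i)" for m :: "nat \<Rightarrow>\<^sub>0 nat"
  have P_add: "P (u + v) \<longleftrightarrow> P u \<or> P v" for u v by (auto simp: P_def lookup_add)
  define free where "free p = restrict_monomials (\<lambda>m. \<not> P m) p" for p :: "'k mpoly"
  have free_S: "free p \<in> carrier (coord_ring n)" if "p \<in> carrier (coord_ring n)" for p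
    using that by (auto simp: free_def in_coord_ring_iff keys_restrict_monomials)
  have diff: "p - free p \<in> ?Q" if p: "p \<in> carrier (coord_ring n)" for p
  proof -
    have "Poly_Mapping.keys (p - free p) = {m \<in> Poly_Mapping.keys p. P m}"
      by (auto simp: in_keys_iff lookup_minus free_def lookup_restrict_monomials split: if_splits)
    then show ?thesis using p by (auto simp: mem_variable_ideal_iff in_coord_ring_iff P_def)
  qed
  have "a * b - (b * (a - free a) + free a * (b - free b)) \<in> ?Q"
    by (rule ideal_diff[OF Q ab ideal_add[OF Q ideal_mult[OF Q b diff[OF a]]
          ideal_mult[OF Q free_S[OF a] diff[OF b]]]])
  then have "free a * free b \<in> ?Q" by (simp add: algebra_simps)
  moreover have "\<not> P m" if "m \<in> Poly_Mapping.keys (free a * free b)" for m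
    using subsetD[OF keys_mult that] by (auto simp: P_add free_def keys_restrict_monomials)
  ultimately have "Poly_Mapping.keys (free a * free b) = {}"
    unfolding mem_variable_ideal_iff P_def by (metis all_not_in_conv)
  then have "free a = 0 \<or> free b = 0" by simp
  then show "a \<in> ?Q \<or> b \<in> ?Q" using diff[OF a] diff[OF b] by auto
qed

lemma variable_ideal_in_proj_points:
  assumes "j \<le> n"
  shows "variable_ideal n j \<in> proj_points n"
proof -
  have "variable n \<notin> variable_ideal n j" using assms by (simp add: variable_mem_variable_ideal_iff)
  then show ?thesis
    by (auto simp: proj_points_def homogeneous_ideal_iff_graded graded_variable_ideal
        primeideal_variable_ideal)
qed

lemma proj_pointsD:
  assumes "P \<in> proj_points n"
  shows proj_points_graded: "graded_ideal n P"
    and proj_points_prime: "a \<in> carrier (coord_ring n) \<Longrightarrow> b \<in> carrier (coord_ring n) \<Longrightarrow> a * b \<in> P \<Longrightarrow> a \<in> P \<or> b \<in> P"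
  using assms primeideal.I_prime[of P "coord_ring n" a b]
  by (auto simp: proj_points_def homogeneous_ideal_iff_graded)

lemma variable_ideal_psubset: "j \<le> n \<Longrightarrow> variable_ideal n j \<subset> (variable_ideal n (Suc j) :: 'k::field mpoly set)"
proof
  assume "j \<le> n"
  then have "variable j \<in> variable_ideal n (Suc j)" "variable j \<notin> (variable_ideal n j :: 'k mpoly set)"
    by (simp_all add: variable_mem_variable_ideal_iff)
  then show "variable_ideal n j \<noteq> (variable_ideal n (Suc j) :: 'k mpoly set)" by blast
  show "variable_ideal n j \<subseteq> (variable_ideal n (Suc j) :: 'k mpoly set)"
    by (rule subsetI) (simp add: mem_variable_ideal_iff, metis less_SucI)
qed

text \<open>The quotient is a polynomial ring in \<open>n + 1 - j\<close> variables. For \<open>j = 0\<close> the ideal is zero and the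
  formula is the Hilbert function of the whole coordinate ring.\<close>

lemma hilbert_function_variable_ideal:
  assumes "j \<le> n"
  shows "hilbert_function n (variable_ideal n j :: 'k::field mpoly set) d = (n - j + d) choose (n - j)"
proof -
  let ?as = "replicate j (1::nat)" and ?Q = "variable_ideal n j :: 'k mpoly set"
  let ?H = "hilbert_series n ?Q"
  have len: "length ?as \<le> Suc n" using assms by simp
  have "?H * (1 - fps_X) ^ Suc n = prod_list (map (\<lambda>a. 1 - fps_X ^ a) ?as)"
    using hilbert_series_regular_sequence[OF regular_sequence_variable_powers[OF len]
        homogeneous_variable_powers, where 'k='k]
    unfolding genideal_variable_powers[OF len] variable_ideal_def by simp
  then have "?H * (1 - fps_X) ^ Suc (n - j) * (1 - fps_X) ^ j = (1 :: rat fps) * (1 - fps_X) ^ j"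
    using assms by (simp add: mult.assoc flip: power_add power_Suc)
  moreover have "(1 - fps_X :: rat fps) ^ j \<noteq> 0" 
    using fps_nonzero_nth[of "1 - fps_X :: rat fps"] by (auto intro!: exI[of _ 0])
  ultimately have "?H * (1 - fps_X) ^ Suc (n - j) = 1" by (simp only: mult_cancel_right) simp
  then have "?H = inverse ((1 - fps_X) ^ Suc (n - j))"
    by (metis fps_inverse_unique mult.commute)
  also have "\<dots> = Abs_fps (\<lambda>k. of_nat ((n - j + k) choose k))"
    using one_minus_const_fps_X_neg_power'[of "Suc (n - j)" "1::rat"] by simp
  finally have "fps_nth ?H d = of_nat ((n - j + d) choose d)" by simp
  then show ?thesis
    by (simp add: hilbert_series_def binomial_symmetric[of d "n - j + d"])
qed

text \<open>Growth at least of the order of \<open>d^k\<close>. Binomial coefficients in place of powers make this notion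
  compatible with summation, by Pascal's rule.\<close>

definition grows_with_degree :: "nat \<Rightarrow> (nat \<Rightarrow> nat) \<Rightarrow> bool" where
  "grows_with_degree k h \<longleftrightarrow> (\<exists>N. \<forall>j d. N * j \<le> d \<longrightarrow> j choose k \<le> h d)"

lemma grows_with_degree_Suc:
  assumes "grows_with_degree k h'" and step: "\<And>d. e \<le> d \<Longrightarrow> h (d - e) + h' d \<le> h d"
  shows "grows_with_degree (Suc k) h"
proof -
  obtain N where N: "\<And>j d. N * j \<le> d \<Longrightarrow> j choose k \<le> h' d"
    using assms(1) by (auto simp: grows_with_degree_def)
  \<comment> \<open>Passing from \<open>j + 1\<close> to \<open>j\<close> frees \<open>N + e\<close> degrees, enough to lower \<open>d\<close> by \<open>e\<close>.\<close>
  have "j choose Suc k \<le> h d" if "(N + e) * j \<le> d" for j d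
    using that
  proof (induction j arbitrary: d)
    case (Suc j)
    have "(N + e) * j + N + e \<le> d" using Suc.prems by (simp add: algebra_simps)
    then have "e \<le> d" "(N + e) * j \<le> d - e" "N * j \<le> d" by (simp_all add: algebra_simps)
    then have "j choose Suc k \<le> h (d - e)" "j choose k \<le> h' d" "h (d - e) + h' d \<le> h d"
      using Suc.IH N step by auto
    then show ?case by simp
  qed simp
  then show ?thesis unfolding grows_with_degree_def by blast
qed

text \<open>A homogeneous \<open>f\<close> of degree \<open>e\<close> in \<open>P'\<close> but not in the prime \<open>P\<close> is a nonzerodivisor modulo \<open>P\<close>, so
  \<open>H\<^sub>P(d) - H\<^sub>P(d - e)\<close> is the Hilbert function of \<open>P + f S \<subseteq> P'\<close> and dominates that of \<open>P'\<close>.\<close>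

lemma grows_with_degree_proj_points:
  assumes P: "P \<in> proj_points n" "P' \<in> proj_points n" "P \<subset> P'"
    and "grows_with_degree k (hilbert_function n P')"
  shows "grows_with_degree (Suc k) (hilbert_function n P)"
proof -
  note gr = proj_points_graded[OF P(1)] proj_points_graded[OF P(2)]
  note id = graded_ideal_ideal[OF gr(1)] graded_ideal_ideal[OF gr(2)]
  obtain p where p: "p \<in> P'" "p \<notin> P" using P by blast
  obtain N where N: "p = (\<Sum>e\<le>N. component e p)" by (rule sum_components)
  obtain e where "component e p \<notin> P"
    using p(2) ideal_sum[OF id(1), of "{..N}" "\<lambda>e. component e p"] N by metis
  then obtain f where f: "f \<in> P'" "f \<notin> P" "homogeneous e f"
    using graded_ideal_component[OF gr(2) p(1)] homogeneous_component by blast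
  have fS: "f \<in> carrier (coord_ring n)" using f ideal_subset[OF id(2)] by blast
  let ?J = "{i + f * g | i g. i \<in> P \<and> g \<in> carrier (coord_ring n)}"
  have "?J \<subseteq> P'"
    using P f by (auto intro!: ideal_add[OF id(2)] ideal_mult[OF id(2)] simp: mult.commute[of f])
  then have mono: "hilbert_function n P' d \<le> hilbert_function n ?J d" for d
    by (rule hilbert_function_antimono[OF _ ideal_subset[OF id(2)]])
  have eq: "hilbert_function n ?J d + (if e \<le> d then hilbert_function n P (d - e) else 0) = hilbert_function n P d" for d
    using proj_points_prime[OF P(1) fS] f
    by (intro hilbert_function_add_nonzerodivisor[OF gr(1) fS f(3)]) blast
  show ?thesis
  proof (rule grows_with_degree_Suc[OF assms(4)])
    fix d assume "e \<le> d"
    then show "hilbert_function n P (d - e) + hilbert_function n P' d \<le> hilbert_function n P d"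
      using mono[of d] eq[of d] by simp
  qed
qed

lemma grows_with_degree_chain:
  assumes "\<forall>i\<le>r. C i \<in> proj_points n" "\<forall>i<r. C i \<subset> C (Suc i)"
    and "grows_with_degree k (hilbert_function n (C r))"
  shows "grows_with_degree (k + r) (hilbert_function n (C 0))"
  using assms
proof (induction r arbitrary: k)
  case (Suc r)
  then have "grows_with_degree (Suc k) (hilbert_function n (C r))"
    by (intro grows_with_degree_proj_points[of "C r" n "C (Suc r)"]) auto
  then show ?case using Suc.IH[of "Suc k"] Suc.prems by simp
qed simp

lemma grows_with_degree_variable_ideal:
  assumes "j \<le> n"
  shows "grows_with_degree (n - j) (hilbert_function n (variable_ideal n j))"
proof -
  have "i choose (n - j) \<le> (n - j + d) choose (n - j)" if "i \<le> d" for i d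
    by (rule binomial_right_mono) (use that in simp)
  then show ?thesis
    unfolding grows_with_degree_def hilbert_function_variable_ideal[OF assms]
    by (intro exI[of _ 1]) simp
qed

text \<open>A Hilbert function is bounded by that of the zero ideal, which is a polynomial of degree \<open>n\<close> in the
  degree.\<close>

lemma grows_with_degree_le:
  fixes P :: "'k::field mpoly set"
  assumes "ideal P (coord_ring n)" "grows_with_degree k (hilbert_function n P)"
  shows "k \<le> n"
proof (rule ccontr)
  assume "\<not> k \<le> n"
  obtain N where N: "\<And>j d. N * j \<le> d \<Longrightarrow> j choose k \<le> hilbert_function n P d"
    using assms(2) by (auto simp: grows_with_degree_def)
  have "variable_ideal n 0 \<subseteq> P"
  proof
    fix p :: "'k mpoly" assume "p \<in> variable_ideal n 0"
    then have "Poly_Mapping.keys p = {}" by (auto simp: mem_variable_ideal_iff)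
    then show "p \<in> P" using ideal_0[OF assms(1)] by simp
  qed
  then have bound: "hilbert_function n P d \<le> (n + d) ^ n" for d
    using hilbert_function_antimono[of "variable_ideal n 0" P n d] ideal_subset[OF assms(1)]
      binomial_le_pow[of n "n + d"]
    by (simp add: hilbert_function_variable_ideal)
  \<comment> \<open>At \<open>j = k * i\<close> the lower bound is at least \<open>i ^ k\<close> and the upper bound at most \<open>B * i ^ n\<close>, so any
    \<open>i > B\<close> contradicts \<open>k > n\<close>.\<close>
  define B where "B = (n + N * k) ^ n"
  define i where "i = Suc B"
  have "of_nat (i ^ Suc n) \<le> (of_nat (i ^ k) :: rat)"
    unfolding of_nat_le_iff using \<open>\<not> k \<le> n\<close> by (intro power_increasing) (simp_all add: i_def)
  also have "\<dots> = (of_nat (k * i) / of_nat k) ^ k"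
    using \<open>\<not> k \<le> n\<close> by simp
  also have "\<dots> \<le> of_nat ((k * i) choose k)"
    by (rule binomial_ge_n_over_k_pow_k) (simp add: i_def)
  finally have "i ^ Suc n \<le> (k * i) choose k" by (simp only: of_nat_le_iff)
  also have "\<dots> \<le> (n + N * (k * i)) ^ n" using N[of "k * i" "N * (k * i)"] bound[of "N * (k * i)"] by simp
  also have "\<dots> \<le> ((n + N * k) * i) ^ n"
    by (intro power_mono) (simp_all add: i_def algebra_simps)
  also have "\<dots> = B * i ^ n" by (simp add: B_def power_mult_distrib)
  also have "\<dots> < i ^ Suc n" by (simp add: i_def)
  finally show False by simp
qed

text \<open>The Hilbert function of \<open>(x\<^sub>0, \<dots>, x\<^sub>c\<^sub>-\<^sub>1)\<close> has growth of order \<open>n - c\<close>. A chain of \<open>r\<close> strict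
  inclusions below this prime raises the order to at least \<open>n - c + r\<close>, which cannot exceed \<open>n\<close>.\<close>

lemma point_codim_variable_ideal_le:
  assumes "c \<le> n"
  shows "point_codim n (variable_ideal n c :: 'k::field mpoly set) \<le> enat c"
  unfolding point_codim_def
proof (rule Sup_least, clarify)
  fix r and C :: "nat \<Rightarrow> 'k mpoly set"
  assume C: "\<forall>i\<le>r. C i \<in> proj_points n" "\<forall>i<r. C i \<subset> C (Suc i)" "C r = variable_ideal n c"
  have "grows_with_degree (n - c + r) (hilbert_function n (C 0))"
    by (rule grows_with_degree_chain[OF C(1,2)]) (simp add: C(3) grows_with_degree_variable_ideal assms)
  moreover have "ideal (C 0) (coord_ring n)" using C(1) proj_points_graded graded_ideal_ideal by blast
  ultimately have "n - c + r \<le> n" using grows_with_degree_le by blast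
  then show "enat r \<le> enat c" using assms by simp
qed

text \<open>The chain of the primes \<open>(x\<^sub>0, \<dots>, x\<^sub>i\<^sub>-\<^sub>1)\<close> for \<open>i < c\<close> is completed by \<open>P\<close> itself.\<close>

lemma le_point_codim_if_variable_ideal_subset:
  assumes "c \<le> n" "P \<in> proj_points n" "variable_ideal n c \<subseteq> P"
  shows "enat c \<le> point_codim n P"
  unfolding point_codim_def
proof (rule Sup_upper, rule CollectI, intro exI conjI)
  let ?C = "\<lambda>i. if i < c then variable_ideal n i else P"
  show "\<forall>i\<le>c. ?C i \<in> proj_points n"
    using assms by (auto intro!: variable_ideal_in_proj_points)
  show "\<forall>i<c. ?C i \<subset> ?C (Suc i)"
  proof (intro allI impI)
    fix i assume i: "i < c"
    then have "variable_ideal n i \<subset> (variable_ideal n (Suc i) :: 'a mpoly set)"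
      using assms by (intro variable_ideal_psubset) simp
    then show "?C i \<subset> ?C (Suc i)" using i assms(3) by (cases "Suc i = c") auto
  qed
qed simp_all

text \<open>A prime containing \<open>x\<^sub>i^a\<^sub>i\<close> contains \<open>x\<^sub>i\<close>. So \<open>(x\<^sub>0, \<dots>, x\<^sub>c\<^sub>-\<^sub>1)\<close> is the least prime over the
  ideal, and it has the smallest codimension.\<close>

lemma codim_power_ideal:
  assumes "length as \<le> n" "\<forall>a\<in>set as. 0 < a"
  shows "codim n (power_ideal n as :: 'k::field mpoly set) = enat (length as)"
proof (rule antisym)
  let ?I = "power_ideal n as :: 'k mpoly set" and ?Q = "variable_ideal n (length as) :: 'k mpoly set"
  have "?I \<subseteq> ?Q"
  proof
    fix p :: "'k mpoly" assume p: "p \<in> power_ideal n as"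
    have "\<exists>i<length as. 0 < Poly_Mapping.lookup m i"
      if m: "m \<in> Poly_Mapping.keys p" for m
    proof -
      obtain i where "i < length as" "as ! i \<le> Poly_Mapping.lookup m i"
        using p m by (auto simp: power_ideal_def)
      then show ?thesis using assms(2) nth_mem by (metis order_less_le_trans)
    qed
    then show "p \<in> ?Q" using p by (auto simp: mem_variable_ideal_iff power_ideal_def)
  qed
  then have "codim n ?I \<le> point_codim n ?Q"
    using variable_ideal_in_proj_points[OF assms(1)] unfolding codim_def by (intro INF_lower) blast
  then show "codim n ?I \<le> enat (length as)"
    using point_codim_variable_ideal_le[OF assms(1), where 'k='k] by (rule order_trans)
  show "enat (length as) \<le> codim n ?I"
    unfolding codim_def
  proof (rule INF_greatest)
    fix P assume "P \<in> {P \<in> proj_points n. ?I \<subseteq> P}"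
    then have P: "P \<in> proj_points n" "?I \<subseteq> P" by auto
    note id = graded_ideal_ideal[OF proj_points_graded[OF P(1)]]
    have "variable i \<in> P" if i: "i < length as" for i
    proof -
      have S: "variable i ^ e \<in> carrier (coord_ring n)" for e
        using i assms(1) by (intro coord_ring_variable_power) simp
      have "variable i ^ (as ! i) \<in> ?I"
        using i S by (auto simp: power_ideal_def variable_power)
      then have "variable i ^ (as ! i) \<in> P" using P by blast
      moreover have "variable i \<in> P" if "variable i ^ Suc e \<in> P" for e
        using that
      proof (induction e)
        case (Suc e)
        then show ?case
          using proj_points_prime[OF P(1) S[of 1] S[of "Suc e"]] by auto
      qed simp
      moreover have "0 < as ! i" using i assms(2) by simp
      ultimately show ?thesis by (metis gr0_conv_Suc)
    qed
    then have "?Q \<subseteq> P"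
      using assms(1) by (subst variable_ideal_eq_genideal) (auto intro!: coord.genideal_minimal[OF id])
    then show "enat (length as) \<le> point_codim n P"
      by (rule le_point_codim_if_variable_ideal_subset[OF assms(1) P(1)])
  qed
qed

lemma defining_ideal_power_ideal:
  assumes "length as \<le> n"
  shows "defining_ideal n (power_ideal n as :: 'k::field mpoly set)"
  unfolding defining_ideal_def homogeneous_ideal_iff_graded
  using power_ideal_cancel_variable[OF assms] graded_power_ideal by blast

lemma complete_intersection_power_ideal:
  assumes "length as \<le> n" "\<forall>a\<in>set as. 0 < a"
  shows "complete_intersection n as (power_ideal n as :: 'k::field mpoly set)"
  unfolding complete_intersection_def
proof (intro conjI exI)
  show "power_ideal n as = genideal (coord_ring n) (set (variable_powers as) :: 'k mpoly set)"
    using assms by (simp add: genideal_variable_powers)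
qed (use assms in \<open>simp_all add: defining_ideal_power_ideal codim_power_ideal
      homogeneous_variable_powers regular_sequence_variable_powers\<close>)

section \<open>Hilbert polynomials\<close>

text \<open>Here and below \<open>[:0, 1:]\<close> is the indeterminate \<open>t\<close>, and \<open>[:1, -1:]\<close> is \<open>1 - t\<close>.\<close>

definition hilbert_numerator :: "nat list \<Rightarrow> rat poly" where
  "hilbert_numerator as = prod_list (map (\<lambda>a. 1 - [:0, 1:] ^ a) as)"

lemma fps_of_poly_one_minus: "fps_of_poly [:1, -1 :: 'a::comm_ring_1:] = 1 - fps_X"
proof -
  have "[:1, -1 :: 'a:] = 1 - [:0, 1:]" by (simp add: one_pCons)
  then show ?thesis by (simp only: fps_of_poly_diff fps_of_poly_1 fps_of_poly_fps_X)
qed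

lemma hilbert_series_complete_intersection:
  assumes "complete_intersection n as I"
  shows "hilbert_series n I * (1 - fps_X) ^ Suc n = fps_of_poly (hilbert_numerator as)"
proof -
  obtain fs where "list_all2 homogeneous as fs" "regular_sequence n fs"
    "I = genideal (coord_ring n) (set fs)"
    using assms by (auto simp: complete_intersection_def)
  moreover have "fps_of_poly (hilbert_numerator as) = prod_list (map (\<lambda>a. 1 - fps_X ^ a) as)"
    by (simp add: hilbert_numerator_def fps_of_poly_prod_list o_def fps_of_poly_diff fps_of_poly_power)
  ultimately show ?thesis using hilbert_series_regular_sequence by metis
qed

lemma poly_eq_if_eq_on_infinite:
  fixes p q :: "'a::idom poly"
  assumes "infinite A" "\<And>x. x \<in> A \<Longrightarrow> poly p x = poly q x"
  shows "p = q"
proof (rule ccontr)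
  assume "p \<noteq> q"
  then have "finite {x. poly (p - q) x = 0}" by (intro poly_roots_finite) simp
  moreover have "A \<subseteq> {x. poly (p - q) x = 0}" using assms(2) by auto
  ultimately show False using assms(1) finite_subset by blast
qed

lemma binomial_eq_poly:
  "\<exists>b :: rat poly. \<forall>d. poly b (of_nat d) = of_nat ((m + d) choose d)"
proof (intro exI allI)
  let ?b = "smult (1 / fact m) (\<Prod>i = 0..<m. [:of_nat m - of_nat i, 1:]) :: rat poly"
  fix d
  have "(of_nat ((m + d) choose d) :: rat) = of_nat ((m + d) choose m)"
    using binomial_symmetric[of d "m + d"] by simp
  also have "\<dots> = of_nat (m + d) gchoose m" by (rule binomial_gbinomial)
  also have "\<dots> = poly ?b (of_nat d)"
    by (simp add: gbinomial_prod_rev poly_prod algebra_simps)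
  finally show "poly ?b (of_nat d) = of_nat ((m + d) choose d)" ..
qed

text \<open>The coefficients of \<open>1 / (1 - t)^(m+1)\<close> are polynomial in the exponent. Multiplication by \<open>A\<close> adds
  up finitely many shifts of them, all of which are given by that polynomial from the degree of \<open>A\<close> on.\<close>

lemma eventually_poly_if_rational:
  fixes f :: "rat fps"
  assumes "f * (1 - fps_X) ^ Suc m = fps_of_poly A"
  shows "\<exists>P. eventually (\<lambda>d. poly P (of_nat d) = fps_nth f d) sequentially"
proof -
  let ?B = "Abs_fps (\<lambda>k. of_nat ((m + k) choose k)) :: rat fps"
  have B: "inverse ((1 - fps_X) ^ Suc m) = ?B"
    using one_minus_const_fps_X_neg_power'[of "Suc m" "1::rat"] by simp
  have "(1 - fps_X :: rat fps) ^ Suc m * inverse ((1 - fps_X) ^ Suc m) = 1"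
    by (rule inverse_mult_eq_1') (simp add: fps_power_zeroth)
  then have "f = f * (1 - fps_X) ^ Suc m * inverse ((1 - fps_X) ^ Suc m)"
    unfolding mult.assoc by simp
  then have f: "f = fps_of_poly A * ?B" by (simp only: B assms)
  obtain b :: "rat poly" where b: "\<And>d. poly b (of_nat d) = of_nat ((m + d) choose d)"
    using binomial_eq_poly[of m] by metis
  define P where "P = (\<Sum>i\<le>degree A. smult (coeff A i) (pcompose b [:- of_nat i, 1:]))"
  have "poly P (of_nat d) = fps_nth f d" if d: "d \<ge> degree A" for d
  proof -
    have "fps_nth f d = (\<Sum>i=0..d. coeff A i * of_nat ((m + (d - i)) choose (d - i)))"
      unfolding f fps_mult_nth by simp
    also have "\<dots> = (\<Sum>i\<le>degree A. coeff A i * of_nat ((m + (d - i)) choose (d - i)))"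
      using d by (intro sum.mono_neutral_right) (auto simp: coeff_eq_0)
    also have "\<dots> = (\<Sum>i\<le>degree A. coeff A i * poly b (of_nat (d - i)))"
      by (simp only: b)
    also have "\<dots> = (\<Sum>i\<le>degree A. coeff A i * poly b (of_nat d - of_nat i))"
      using d by (intro sum.cong) (simp_all add: of_nat_diff)
    also have "\<dots> = poly P (of_nat d)"
      by (simp add: P_def poly_sum poly_pcompose)
    finally show ?thesis ..
  qed
  then show ?thesis unfolding eventually_sequentially by blast
qed

text \<open>Existence and uniqueness of the polynomial are what give the definite description its meaning.\<close>

lemma eventually_hilbert_polynomial:
  assumes "complete_intersection n as I"
  shows "eventually (\<lambda>d. poly (hilbert_polynomial n I) (of_nat d) = of_nat (hilbert_function n I d)) sequentially"
  unfolding hilbert_polynomial_def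
proof (rule theI')
  let ?E = "\<lambda>P. eventually (\<lambda>d. poly P (of_nat d) = (of_nat (hilbert_function n I d) :: rat)) sequentially"
  obtain P where P: "?E P"
    using eventually_poly_if_rational[OF hilbert_series_complete_intersection[OF assms]]
    by (auto simp: hilbert_series_def)
  show "\<exists>!P. ?E P"
  proof (intro ex1I[of _ P] P)
    fix Q assume "?E Q"
    with P have "eventually (\<lambda>d. poly P (of_nat d) = poly Q (of_nat d)) sequentially"
      by eventually_elim simp
    then obtain N where N: "\<And>d. N \<le> d \<Longrightarrow> poly P (of_nat d) = poly Q (of_nat d)"
      by (auto simp: eventually_sequentially)
    have "infinite ((of_nat :: nat \<Rightarrow> rat) ` {N..})"
      by (subst finite_image_iff) (simp_all add: inj_on_def infinite_Ici)
    then show "Q = P"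
      by (rule poly_eq_if_eq_on_infinite) (use N in auto)
  qed
qed

lemma hilbert_polynomial_eq_iff_eventually:
  assumes "complete_intersection n as I" "complete_intersection n bs J"
  shows "hilbert_polynomial n I = hilbert_polynomial n J \<longleftrightarrow>
    eventually (\<lambda>d. hilbert_function n I d = hilbert_function n J d) sequentially" (is "?L \<longleftrightarrow> ?R")
proof
  assume L: ?L
  have "eventually (\<lambda>d. of_nat (hilbert_function n I d) = (of_nat (hilbert_function n J d) :: rat)) sequentially"
    using eventually_hilbert_polynomial[OF assms(1), unfolded L] eventually_hilbert_polynomial[OF assms(2)]
    by eventually_elim simp
  then show ?R by simp
next
  assume ?R
  then have "eventually (\<lambda>d. poly P (of_nat d) = (of_nat (hilbert_function n I d) :: rat)) sequentially \<longleftrightarrow>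
      eventually (\<lambda>d. poly P (of_nat d) = (of_nat (hilbert_function n J d) :: rat)) sequentially" for P
    by (intro eventually_subst) (auto elim: eventually_mono)
  then show ?L unfolding hilbert_polynomial_def by simp
qed

text \<open>Connects agreement of two Hilbert functions in large degrees with divisibility of polynomials.\<close>

lemma eventually_zero_iff_fps_of_poly:
  fixes f :: "'a::comm_ring_1 fps"
  shows "eventually (\<lambda>d. fps_nth f d = 0) sequentially \<longleftrightarrow> (\<exists>G. f = fps_of_poly G)"
proof
  assume "eventually (\<lambda>d. fps_nth f d = 0) sequentially"
  then obtain N where "\<And>d. N \<le> d \<Longrightarrow> fps_nth f d = 0" by (auto simp: eventually_sequentially)
  then have "f = fps_of_poly (truncate_fps N f)"
    by (intro fps_ext) (simp add: not_less)
  then show "\<exists>G. f = fps_of_poly G" ..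
next
  assume "\<exists>G. f = fps_of_poly G"
  then obtain G where G: "f = fps_of_poly G" ..
  show "eventually (\<lambda>d. fps_nth f d = 0) sequentially"
    unfolding eventually_sequentially
    by (intro exI[of _ "Suc (degree G)"]) (auto simp: G coeff_eq_0)
qed

lemma hilbert_polynomial_eq_iff_dvd:
  assumes "complete_intersection n as I" "complete_intersection n bs J"
  shows "hilbert_polynomial n I = hilbert_polynomial n J \<longleftrightarrow>
    [:1, -1:] ^ Suc n dvd hilbert_numerator as - hilbert_numerator bs"
proof -
  let ?f = "hilbert_series n I - hilbert_series n J" and ?q = "(1 - fps_X :: rat fps) ^ Suc n"
  have q: "?q \<noteq> 0"
    by (rule fps_nonzeroI[of _ 0]) (simp add: fps_power_zeroth)
  have f: "?f * ?q = fps_of_poly (hilbert_numerator as - hilbert_numerator bs)"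
    by (simp only: left_diff_distrib fps_of_poly_diff hilbert_series_complete_intersection[OF assms(1)]
        hilbert_series_complete_intersection[OF assms(2)])
  have "?f = fps_of_poly G \<longleftrightarrow> hilbert_numerator as - hilbert_numerator bs = [:1, -1:] ^ Suc n * G" for G
  proof -
    have "?f = fps_of_poly G \<longleftrightarrow> ?f * ?q = fps_of_poly G * ?q" using q by (simp only: mult_cancel_right) simp
    also have "fps_of_poly G * ?q = fps_of_poly ([:1, -1:] ^ Suc n * G)"
      by (simp only: fps_of_poly_mult fps_of_poly_power fps_of_poly_one_minus mult.commute)
    finally show ?thesis by (simp only: f fps_of_poly_eq_iff)
  qed
  then have "[:1, -1:] ^ Suc n dvd hilbert_numerator as - hilbert_numerator bs \<longleftrightarrow> (\<exists>G. ?f = fps_of_poly G)"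
    by (simp only: dvd_def)
  also have "\<dots> \<longleftrightarrow> eventually (\<lambda>d. fps_nth ?f d = 0) sequentially"
    by (rule eventually_zero_iff_fps_of_poly[symmetric])
  finally show ?thesis
    unfolding hilbert_polynomial_eq_iff_eventually[OF assms] by (simp add: hilbert_series_def)
qed

text \<open>The degree sequences of complete intersections of codimension \<open>c \<le> n\<close> are all sequences of \<open>c\<close>
  positive integers, by \<open>complete_intersection_power_ideal\<close>. Geometry disappears from the
  notion of firmness.\<close>

lemma not_firm_iff:
  assumes "1 \<le> c" "c \<le> n"
  shows "\<not> firm TYPE('k::{alg_closed_field, field_char_0}) c n \<longleftrightarrow>
    (\<exists>as bs. length as = c \<and> length bs = c \<and> (\<forall>a\<in>set as. 0 < a) \<and> (\<forall>b\<in>set bs. 0 < b) \<and>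
      [:1, -1:] ^ Suc n dvd hilbert_numerator as - hilbert_numerator bs \<and> mset bs \<noteq> mset as)"
    (is "?L \<longleftrightarrow> ?R")
proof
  assume ?L
  then obtain as bs and I J :: "'k mpoly set" where *: "length as = c" "length bs = c"
    "complete_intersection n as I" "complete_intersection n bs J"
    "hilbert_polynomial n I = hilbert_polynomial n J" "mset bs \<noteq> mset as"
    using assms by (auto simp: firm_def)
  moreover have "\<forall>a\<in>set as. 0 < a" "\<forall>b\<in>set bs. 0 < b"
    using * by (auto simp: complete_intersection_def)
  ultimately show ?R using hilbert_polynomial_eq_iff_dvd[OF *(3,4)] by blast
next
  assume ?R
  then obtain as bs where *: "length as = c" "length bs = c" "\<forall>a\<in>set as. 0 < a" "\<forall>b\<in>set bs. 0 < b"
    "[:1, -1:] ^ Suc n dvd hilbert_numerator as - hilbert_numerator bs" "mset bs \<noteq> mset as" by blast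
  have ci: "complete_intersection n as (power_ideal n as :: 'k mpoly set)"
    "complete_intersection n bs (power_ideal n bs :: 'k mpoly set)"
    using * assms by (auto intro!: complete_intersection_power_ideal)
  show ?L
    using * ci hilbert_polynomial_eq_iff_dvd[OF ci] unfolding firm_def by blast
qed

section \<open>Vanishing order at one\<close>

text \<open>The cofactor of \<open>(1 - t)^c\<close> in the numerator; for positive degrees it does not vanish at \<open>1\<close>.\<close>

definition reduced_numerator :: "nat list \<Rightarrow> rat poly" where
  "reduced_numerator as = prod_list (map (\<lambda>a. \<Sum>i<a. [:0, 1:] ^ i) as)"

lemma hilbert_numerator_eq: "hilbert_numerator as = [:1, -1:] ^ length as * reduced_numerator as"
proof (induction as)
  case (Cons a as)
  have "1 - [:0, 1:] ^ a = [:1, -1:] * (\<Sum>i<a. [:0, 1 :: rat:] ^ i)"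
    using one_diff_power_eq[of "[:0, 1 :: rat:]" a] by (simp add: one_pCons)
  then show ?case
    using Cons by (simp only: hilbert_numerator_def reduced_numerator_def list.map prod_list.Cons
        length_Cons power_Suc mult_ac)
qed (simp add: hilbert_numerator_def reduced_numerator_def)

lemma poly_reduced_numerator_1: "poly (reduced_numerator as) 1 = of_nat (prod_list as)"
  by (induction as) (simp_all add: reduced_numerator_def poly_sum)

lemma poly_pderiv_geometric_sum: "2 * poly (pderiv (\<Sum>i<a. [:0, 1 :: rat:] ^ i)) 1 = of_nat a * (of_nat a - 1)"
  by (induction a) (simp_all add: pderiv_add pderiv_power pderiv_pCons algebra_simps)

lemma poly_pderiv_reduced_numerator_1:
  "2 * poly (pderiv (reduced_numerator as)) 1
    = of_nat (prod_list as) * (of_nat (sum_list as) - of_nat (length as))"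
proof (induction as)
  case (Cons a as)
  let ?g = "\<Sum>i<a. [:0, 1 :: rat:] ^ i" and ?r = "reduced_numerator as"
  have g: "poly ?g 1 = of_nat a" by (simp add: poly_sum)
  have "reduced_numerator (a # as) = ?g * ?r" by (simp add: reduced_numerator_def)
  then have "2 * poly (pderiv (reduced_numerator (a # as))) 1
      = of_nat a * (2 * poly (pderiv ?r) 1) + poly ?r 1 * (2 * poly (pderiv ?g) 1)"
    by (simp only: pderiv_mult poly_add poly_mult g) (simp add: algebra_simps)
  then show ?case
    unfolding Cons.IH poly_pderiv_geometric_sum poly_reduced_numerator_1
    by (simp add: algebra_simps)
qed (simp add: reduced_numerator_def)

lemma square_dvd_iff:
  fixes p :: "rat poly"
  shows "[:1, -1:] ^ 2 dvd p \<longleftrightarrow> poly p 1 = 0 \<and> poly (pderiv p) 1 = 0"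
proof
  assume "[:1, -1:] ^ 2 dvd p"
  then obtain g where "p = [:1, -1:] ^ 2 * g" by (rule dvdE)
  then have "p = [:1, -1:] * ([:1, -1:] * g)" by (simp only: power2_eq_square mult.assoc)
  then show "poly p 1 = 0 \<and> poly (pderiv p) 1 = 0"
    by (simp only: pderiv_mult) simp
next
  assume *: "poly p 1 = 0 \<and> poly (pderiv p) 1 = 0"
  then obtain g where g: "p = [:-1, 1:] * g" by (auto simp: poly_eq_0_iff_dvd)
  have "poly (pderiv p) 1 = poly g 1" unfolding g pderiv_mult by (simp add: pderiv_pCons)
  then obtain h where "g = [:-1, 1:] * h" using * by (auto simp: poly_eq_0_iff_dvd)
  then have "p = ([:-1, 1:] * [:-1, 1:]) * h" using g by (simp only: mult.assoc)
  also have "[:-1, 1:] * [:-1, 1:] = [:1, -1 :: rat:] ^ 2" by (simp add: power2_eq_square)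
  finally show "[:1, -1:] ^ 2 dvd p" by simp
qed

text \<open>After cancelling \<open>(1 - t)^c\<close>, the condition compares values and first derivatives of the reduced
  numerators at \<open>1\<close>. The value is the product of the degrees, and the derivative is the product times
  half of the sum of the \<open>a\<^sub>i - 1\<close>; the product is nonzero, so the sums can be compared.\<close>

lemma dvd_numerator_diff_iff:
  assumes "length as = c" "length bs = c" "\<forall>a\<in>set as. 0 < a"
  shows "[:1, -1:] ^ (c + 2) dvd hilbert_numerator as - hilbert_numerator bs \<longleftrightarrow>
    prod_list as = prod_list bs \<and> sum_list as = sum_list bs"
proof -
  let ?r = "reduced_numerator as - reduced_numerator bs"
  have "prod_list as \<noteq> 0" using assms(3) by (auto simp: prod_list_zero_iff)
  have "hilbert_numerator as - hilbert_numerator bs = [:1, -1:] ^ c * ?r"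
    using assms by (simp only: hilbert_numerator_eq right_diff_distrib)
  then have "[:1, -1:] ^ (c + 2) dvd hilbert_numerator as - hilbert_numerator bs \<longleftrightarrow> [:1, -1:] ^ 2 dvd ?r"
    by (simp only: power_add dvd_mult_cancel_left) simp
  also have "\<dots> \<longleftrightarrow> poly ?r 1 = 0 \<and> 2 * poly (pderiv ?r) 1 = 0"
    by (simp add: square_dvd_iff)
  also have "\<dots> \<longleftrightarrow> prod_list as = prod_list bs \<and> sum_list as = sum_list bs"
    using assms \<open>prod_list as \<noteq> 0\<close>
    by (auto simp: pderiv_diff right_diff_distrib poly_pderiv_reduced_numerator_1 poly_reduced_numerator_1
        simp flip: of_nat_mult)
  finally show ?thesis .
qed

lemma poly_hilbert_numerator_inverse:
  assumes "x \<noteq> 0"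
  shows "x ^ sum_list as * poly (hilbert_numerator as) (inverse x)
    = (- 1) ^ length as * poly (hilbert_numerator as) x"
proof (induction as)
  case (Cons a as)
  let ?f = "hilbert_numerator as"
  have a: "x ^ a * (1 - inverse x ^ a) = - (1 - x ^ a)"
    using assms by (simp add: algebra_simps power_inverse)
  have "x ^ sum_list (a # as) * poly (hilbert_numerator (a # as)) (inverse x)
      = (x ^ a * (1 - inverse x ^ a)) * (x ^ sum_list as * poly (hilbert_numerator as) (inverse x))"
    by (simp add: hilbert_numerator_def power_add)
  also have "\<dots> = - (1 - x ^ a) * ((- 1) ^ length as * poly ?f x)"
    by (simp only: a Cons.IH)
  also have "\<dots> = (- 1) ^ length (a # as) * poly (hilbert_numerator (a # as)) x"
    by (simp add: hilbert_numerator_def algebra_simps)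
  finally show ?case .
qed (simp add: hilbert_numerator_def)

text \<open>Write \<open>D = (1 - t)^k E\<close>. Equal sums make \<open>D\<close> invariant under \<open>t \<mapsto> 1/t\<close> up to a power of \<open>t\<close> and the
  sign \<open>(-1)^c\<close>, whereas \<open>(1 - t)^k\<close> picks up the sign \<open>(-1)^k\<close>. At the fixed point \<open>1\<close> this gives
  \<open>(-1)^k E(1) = (-1)^c E(1)\<close>, and the signs differ.\<close>

lemma dvd_numerator_diff_Suc:
  assumes "length as = c" "length bs = c" "sum_list as = sum_list bs" "odd (k + c)"
    and "[:1, -1:] ^ k dvd hilbert_numerator as - hilbert_numerator bs" (is "_ dvd ?D")
  shows "[:1, -1:] ^ Suc k dvd hilbert_numerator as - hilbert_numerator bs"
proof -
  obtain E where E: "?D = [:1, -1:] ^ k * E" using assms(5) by (auto simp: dvd_def)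
  let ?s = "sum_list as"
  \<comment> \<open>The symmetry of \<open>E\<close> with denominators cleared. At \<open>x \<noteq> 0\<close> the value of \<open>reflect_poly E\<close> is
    \<open>x ^ degree E\<close> times that of \<open>E\<close> at \<open>inverse x\<close>, and cancelling \<open>(1 - x) ^ k\<close> excludes \<open>x = 1\<close>.\<close>
  let ?l = "smult ((- 1) ^ k) ([:0, 1:] ^ ?s * reflect_poly E)"
    and ?r = "smult ((- 1) ^ c) ([:0, 1:] ^ (k + degree E) * E)"
  have "?l = ?r"
  proof (rule poly_eq_if_eq_on_infinite)
    show "infinite (- {0, 1 :: rat})" by (simp add: infinite_UNIV_char_0 Compl_eq_Diff_UNIV)
    fix x :: rat assume "x \<in> - {0, 1}"
    then have x: "x \<noteq> 0" "1 - x \<noteq> 0" by auto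
    have D: "x ^ ?s * poly ?D (inverse x) = (- 1) ^ c * poly ?D x"
      using poly_hilbert_numerator_inverse[OF x(1), of as] poly_hilbert_numerator_inverse[OF x(1), of bs] assms
      by (simp add: right_diff_distrib)
    have "x * (1 - inverse x) = - (1 - x)" using x by (simp add: algebra_simps)
    then have inv: "x ^ k * (1 - inverse x) ^ k = (- 1) ^ k * (1 - x) ^ k"
      by (metis power_mult_distrib mult_minus1)
    have "(1 - x) ^ k * poly ?l x = x ^ ?s * ((- 1) ^ k * (1 - x) ^ k) * (x ^ degree E * poly E (inverse x))"
      using x by (simp add: poly_reflect_poly_nz)
    also have "\<dots> = x ^ (k + degree E) * (x ^ ?s * poly ?D (inverse x))"
      by (simp add: E power_add flip: inv)
    also have "\<dots> = (1 - x) ^ k * poly ?r x"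
      unfolding D by (simp add: E)
    finally show "poly ?l x = poly ?r x" using x by simp
  qed
  then have "poly ?l 1 = poly ?r 1" by (rule arg_cong)
  then have "(- 1) ^ k * poly E 1 = (- 1) ^ c * poly E 1"
    by (simp add: poly_reflect_poly_nz)
  then have "poly E 1 = 0" using assms(4) by (auto simp: even_add minus_one_power_iff split: if_splits)
  then obtain g where "E = [:-1, 1:] * g" by (auto simp: poly_eq_0_iff_dvd)
  then have "E = [:1, -1:] * (- g)" by simp
  then have "?D = [:1, -1:] ^ Suc k * (- g)" using E by (simp only: power_Suc2 mult.assoc)
  then show ?thesis by (rule dvdI)
qed

section \<open>Firmness\<close>

lemma not_firm_Suc:
  assumes "c > 2" "c \<le> n" "[n = c] (mod 2)" "\<not> firm TYPE('k::{alg_closed_field, field_char_0}) c n"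
  shows "\<not> firm TYPE('k) c (n + 1)"
proof (cases "n = c")
  case True
  \<comment> \<open>Both triples have product \<open>36\<close> and sum \<open>13\<close>.\<close>
  let ?as = "replicate (c - 3) 1 @ [1, 6, 6] :: nat list"
    and ?bs = "replicate (c - 3) 1 @ [2, 2, 9] :: nat list"
  have len: "length ?as = c" "length ?bs = c" and pos: "\<forall>a\<in>set ?as. 0 < a" "\<forall>b\<in>set ?bs. 0 < b"
    using assms(1) by auto
  have "prod_list ?as = prod_list ?bs" "sum_list ?as = sum_list ?bs" by simp_all
  then have "[:1, -1:] ^ (c + 2) dvd hilbert_numerator ?as - hilbert_numerator ?bs"
    using dvd_numerator_diff_iff[OF len pos(1)] by blast
  moreover have "mset ?bs \<noteq> mset ?as"
  proof
    assume "mset ?bs = mset ?as"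
    then have "set ?bs = set ?as" by (rule mset_eq_setD)
    moreover have "9 \<in> set ?bs" "9 \<notin> set ?as" by auto
    ultimately show False by blast
  qed
  ultimately show ?thesis
    using not_firm_iff[of c "n + 1", where 'k='k] assms(1) True len pos by force
next
  case False
  \<comment> \<open>Since \<open>n\<close> and \<open>c\<close> have equal parity, \<open>n \<noteq> c\<close> forces \<open>n \<ge> c + 2\<close>. This makes the sums agree, and
    \<open>n + 1\<close> has the wrong parity to be the exact order of vanishing.\<close>
  have "odd (Suc n + c)" using assms(3) by (simp add: cong_def) presburger
  moreover have n: "c + 2 \<le> Suc n" using assms False by simp
  obtain as bs where *: "length as = c" "length bs = c" "\<forall>a\<in>set as. 0 < a" "\<forall>b\<in>set bs. 0 < b"
    "[:1, -1:] ^ Suc n dvd hilbert_numerator as - hilbert_numerator bs" "mset bs \<noteq> mset as"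
    using assms not_firm_iff[of c n, where 'k='k] by auto
  have "[:1, -1:] ^ (c + 2) dvd hilbert_numerator as - hilbert_numerator bs"
    using dvd_trans[OF le_imp_power_dvd[OF n] *(5)] .
  then have "sum_list as = sum_list bs" using dvd_numerator_diff_iff[OF *(1,2,3)] by blast
  ultimately have "[:1, -1:] ^ Suc (Suc n) dvd hilbert_numerator as - hilbert_numerator bs"
    using dvd_numerator_diff_Suc[OF *(1,2)] *(5) by blast
  then show ?thesis
    using not_firm_iff[of c "n + 1", where 'k='k] assms * by auto
qed

lemma firm_threshold_eqD:
  assumes "firm_threshold TYPE('k::{alg_closed_field, field_char_0}) c = enat N"
  shows "firm TYPE('k) c N" and "n < N \<Longrightarrow> \<not> firm TYPE('k) c n"
proof -
  let ?A = "enat ` {n. firm TYPE('k) c n}"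
  have Inf: "Inf ?A = enat N" using assms by (simp add: firm_threshold_def)
  then have "?A \<noteq> {}" by (metis Inf_enat_def enat.distinct(2))
  then have "enat N \<in> ?A" using Inf by (metis Inf_enat_def LeastI ex_in_conv)
  then show "firm TYPE('k) c N" by auto
  show "\<not> firm TYPE('k) c n" if "n < N"
  proof
    assume "firm TYPE('k) c n"
    then have "Inf ?A \<le> enat n" by (intro Inf_lower) blast
    then show False using Inf that by simp
  qed
qed

theorem corollary3p9:
  fixes c :: nat
  assumes "c > 2"
  shows "(\<forall>n\<ge>c. [n = c] (mod 2) \<longrightarrow>
            \<not> firm TYPE('k::{alg_closed_field, field_char_0}) c n \<longrightarrow>
            \<not> firm TYPE('k) c (n + 1))
       \<and> (\<forall>N :: nat. firm_threshold TYPE('k) c = enat N \<longrightarrow> [N = c] (mod 2))"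
proof (intro conjI allI impI)
  show "\<not> firm TYPE('k) c (n + 1)"
    if "c \<le> n" "[n = c] (mod 2)" "\<not> firm TYPE('k) c n" for n
    using not_firm_Suc[OF assms that] .
next
  fix N assume N: "firm_threshold TYPE('k) c = enat N"
  show "[N = c] (mod 2)"
  proof (rule ccontr)
    assume not_cong: "\<not> [N = c] (mod 2)"
    have "c \<le> N" using firm_threshold_eqD(1)[OF N] by (simp add: firm_def)
    moreover have "N \<noteq> c" using not_cong by auto
    ultimately obtain n where n: "N = n + 1" "c \<le> n" by (metis Suc_eq_plus1 le_SucE less_eqE not0_implies_Suc add_0_right le_zero_eq)
    have "[n = c] (mod 2)" using not_cong n(1) by (simp add: cong_def) presburger
    moreover have "\<not> firm TYPE('k) c n" using firm_threshold_eqD(2)[OF N] n(1) by simp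
    ultimately show False
      using not_firm_Suc[OF assms n(2), where 'k='k] firm_threshold_eqD(1)[OF N] n(1) by simp
  qed
qed

end
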